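(* Let $m,n\ge 1$, let $\phi:[0,+\infty)\to(0,1]$ be non-increasing, and let $\boldsymbol L\in\mathbb R^{m\times n}$ be $\phi$-multiplicatively badly approximable. Let $\varepsilon>0$ and $R>0$ satisfy $R^m/\varepsilon\ge e^m$ (with $e$ the base of the natural logarithm). Then for all $\boldsymbol T=(T_1,\dots,T_n)\in[1,+\infty)^n$, $$\#M(\boldsymbol L,\varepsilon,R,\boldsymbol T)\ll_{m,n}(1+R)^{m+n-1}\Big(\log\frac{R^m}{\varepsilon}\Big)^{m-1}\left[\varepsilon\bar T^{\,n}+\Big(\frac{\varepsilon \bar T^{\,n}}{\phi(\bar T)}\Big)^{\frac{m+n-1}{m+n}}\right],$$ where $\bar T:=(T_1\cdots T_n)^{1/n}$.
   Context: For $x\in\mathbb R$, $\|x\|$ denotes the distance from $x$ to the nearest integer and $x^{+}:=\max\{1,x\}$. The rows of $\boldsymbol L$ are $L_1,\dots,L_m$, and $L_i\boldsymbol q:=\sum_{j}L_{ij}q_j$. A matrix $\boldsymbol L\in\mathbb R^{m\times n}$ is called $\phi$-multiplicatively badly approximable if for all $\boldsymbol q\in\mathbb Z^n\setminus\{\boldsymbol 0\}$, $$q_1^{+}\cdots q_n^{+}\prod_{i=1}^m\|L_i\boldsymbol q\|\ \ge\ \phi\big((q_1^{+}\cdots q_n^{+})^{1/n}\big).$$ For $\varepsilon,R>0$ and $\boldsymbol T\in[1,\infty)^n$, $$M(\boldsymbol L,\varepsilon,R,\boldsymbol T):=\Big\{(\boldsymbol p,\boldsymbol q)\in\mathbb Z^m\times(\mathbb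 Z^n\setminus\{\boldsymbol 0\}):\ \prod_{i=1}^m|L_i\boldsymbol q+p_i|<\varepsilon,\ |L_i\boldsymbol q+p_i|\le R\ (1\le i\le m),\ |q_j|\le T_j\ (1\le j\le n)\Big\}.$$ The notation $X\ll_{z}Y$ means $X\le cY$ for a constant $c$ depending only on $z$. *)

theory Defs
  imports "HOL-Analysis.Analysis"
begin

definition dist_int :: "real \<Rightarrow> real" where
  "dist_int x = \<bar>x - of_int (round x)\<bar>"

definition plus1 :: "real \<Rightarrow> real" where
  "plus1 x = max 1 x"

definition row_app :: "real^'n^'m \<Rightarrow> 'm \<Rightarrow> int^'n \<Rightarrow> real" where
  "row_app L i q = (\<Sum>j\<in>UNIV. L $ i $ j * of_int (q $ j))"

definition mult_bad_approx :: "(real \<Rightarrow> real) \<Rightarrow> real^'n^'m \<Rightarrow> bool" where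
  "mult_bad_approx \<phi> L \<longleftrightarrow>
     (\<forall>q :: int^'n. q \<noteq> 0 \<longrightarrow>
        (\<Prod>j\<in>UNIV. plus1 \<bar>of_int (q $ j)\<bar>) * (\<Prod>i\<in>UNIV. dist_int (row_app L i q))
          \<ge> \<phi> ((\<Prod>j\<in>UNIV. plus1 \<bar>of_int (q $ j)\<bar>) powr (1 / real CARD('n))))"

definition Mset :: "real^'n^'m \<Rightarrow> real \<Rightarrow> real \<Rightarrow> real^'n \<Rightarrow> ((int^'m) \<times> (int^'n)) set" where
  "Mset L \<epsilon> R T = {(p, q). q \<noteq> 0 \<and>
      (\<Prod>i\<in>UNIV. \<bar>row_app L i q + of_int (p $ i)\<bar>) < \<epsilon> \<and>
      (\<forall>i. \<bar>row_app L i q + of_int (p $ i)\<bar> \<le> R) \<and>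
      (\<forall>j. real_of_int \<bar>q $ j\<bar> \<le> T $ j)}"

end

theory Submission
  imports Defs
begin

text \<open>
  Rounding each $L_i q$ to the nearest integer costs a factor $(2R+1)^m$ and leaves vectors
  \<open>q\<close> to be counted, with all distances at most $\min(R,1/2)$. The region
  $\prod|x_i| < \varepsilon$, $|x_i| \le R$ is covered by at most $(\log(R^m/\varepsilon))^{m-1}$
  boxes $|x_i| \le R e^{-s_i}$ of volume $O(\varepsilon)$, the exponents $s_i \in \mathbb{N}$ having
  a fixed sum.

  Within one box, let \<open>D\<close> be the set of differences of the lattice points to be counted.
  If \<open>D\<close> spans the whole space, every vector is congruent modulo the lattice to one of size
  comparable to the box; hence any translate of a dilated box contains at least as many lattice points
  as \<open>D\<close> has, and an average translate contains $O(\varepsilon \bar T^n)$ of them.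
  Otherwise \<open>D\<close> lies in a hyperplane, on which one coordinate (relative to the box) is controlled
  by the others. Pigeonholing in the remaining coordinates, with cells too small to contain two points
  of a multiplicatively badly approximable lattice, gives the second term of the bound.
\<close>

section \<open>Elementary counting: integer points in boxes, fibres, largest values\<close>

lemma card_int_near:
  fixes y A :: real
  assumes "0 \<le> A"
  shows "finite {z::int. \<bar>y + of_int z\<bar> \<le> A}"
    and "real (card {z::int. \<bar>y + of_int z\<bar> \<le> A}) \<le> 2 * A + 1"
proof -
  have eq: "{z::int. \<bar>y + of_int z\<bar> \<le> A} = {\<lceil>- A - y\<rceil>..\<lfloor>A - y\<rfloor>}"
    by (auto simp: abs_le_iff ceiling_le_iff le_floor_iff)
  show "finite {z::int. \<bar>y + of_int z\<bar> \<le> A}"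
    unfolding eq by simp
  have "real_of_int (\<lfloor>A - y\<rfloor> + 1 - \<lceil>- A - y\<rceil>) \<le> 2 * A + 1"
    by linarith
  then show "real (card {z::int. \<bar>y + of_int z\<bar> \<le> A}) \<le> 2 * A + 1"
    unfolding eq using assms by (simp add: of_nat_nat)
qed

lemma card_vec_box:
  fixes S :: "'a::finite \<Rightarrow> 'b set"
  assumes "\<And>i. finite (S i)"
  shows "finite {z :: 'b^'a. \<forall>i. z $ i \<in> S i}"
    and "card {z :: 'b^'a. \<forall>i. z $ i \<in> S i} = (\<Prod>i\<in>UNIV. card (S i))"
proof -
  have bij: "bij_betw vec_lambda (PiE UNIV S) {z :: 'b^'a. \<forall>i. z $ i \<in> S i}"
    by (rule bij_betw_byWitness[where f' = vec_nth]) auto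
  have "finite (PiE UNIV S)"
    using assms by (intro finite_PiE) auto
  then show "finite {z :: 'b^'a. \<forall>i. z $ i \<in> S i}"
    using bij_betw_finite[OF bij] by simp
  show "card {z :: 'b^'a. \<forall>i. z $ i \<in> S i} = (\<Prod>i\<in>UNIV. card (S i))"
    using bij_betw_same_card[OF bij] by (simp add: card_PiE)
qed

lemma card_int_vec_near:
  fixes y A :: "'a::finite \<Rightarrow> real"
  assumes "\<And>i. 0 \<le> A i"
  shows "finite {z :: int^'a. \<forall>i. \<bar>y i + of_int (z $ i)\<bar> \<le> A i}"
    and "real (card {z :: int^'a. \<forall>i. \<bar>y i + of_int (z $ i)\<bar> \<le> A i}) \<le> (\<Prod>i\<in>UNIV. 2 * A i + 1)"
proof -
  define S where "S i = {z::int. \<bar>y i + of_int z\<bar> \<le> A i}" for i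
  have fin: "finite (S i)" for i
    unfolding S_def by (rule card_int_near) (rule assms)
  have eq: "{z :: int^'a. \<forall>i. \<bar>y i + of_int (z $ i)\<bar> \<le> A i} = {z. \<forall>i. z $ i \<in> S i}"
    by (simp add: S_def)
  show "finite {z :: int^'a. \<forall>i. \<bar>y i + of_int (z $ i)\<bar> \<le> A i}"
    unfolding eq by (rule card_vec_box(1)[OF fin])
  have "real (card {z :: int^'a. \<forall>i. z $ i \<in> S i}) = (\<Prod>i\<in>UNIV. real (card (S i)))"
    by (simp add: card_vec_box(2)[OF fin])
  also have "\<dots> \<le> (\<Prod>i\<in>UNIV. 2 * A i + 1)"
    unfolding S_def by (intro prod_mono conjI card_int_near(2) assms) simp
  finally show "real (card {z :: int^'a. \<forall>i. \<bar>y i + of_int (z $ i)\<bar> \<le> A i}) \<le> (\<Prod>i\<in>UNIV. 2 * A i + 1)"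
    unfolding eq .
qed

lemma card_le_image_times_fibre:
  fixes f :: "'a \<Rightarrow> 'b" and B :: real
  assumes "finite A" and "\<And>y. y \<in> f ` A \<Longrightarrow> real (card {x \<in> A. f x = y}) \<le> B"
  shows "real (card A) \<le> real (card (f ` A)) * B"
proof -
  have "real (card A) = (\<Sum>x\<in>A. 1)"
    by simp
  also have "\<dots> = (\<Sum>y\<in>f ` A. \<Sum>x\<in>{x \<in> A. f x = y}. 1)"
    by (rule sum.image_gen[OF assms(1)])
  also have "\<dots> \<le> (\<Sum>y\<in>f ` A. B)"
    using assms(2) by (intro sum_mono) simp
  finally show ?thesis
    by simp
qed

lemma ex_greatest_value:
  fixes f :: "'a::finite \<Rightarrow> 'b::linorder"
  shows "\<exists>x. \<forall>y. f y \<le> f x"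
proof -
  have "Max (range f) \<in> range f"
    by (intro Max_in) auto
  then obtain x where "Max (range f) = f x"
    by (rule imageE)
  moreover have "f y \<le> Max (range f)" for y
    by (intro Max_ge) auto
  ultimately show ?thesis
    by metis
qed

section \<open>Subgroups of a Euclidean space meeting a box\<close>

lemma add_subgroup_int_combination:
  fixes \<Lambda> :: "'a::real_vector set"
  assumes zero: "0 \<in> \<Lambda>" and diff: "\<And>x y. x \<in> \<Lambda> \<Longrightarrow> y \<in> \<Lambda> \<Longrightarrow> x - y \<in> \<Lambda>"
    and B: "finite B" "B \<subseteq> \<Lambda>"
  shows "(\<Sum>v\<in>B. of_int (c v) *\<^sub>R v) \<in> \<Lambda>"
proof -
  have neg: "- x \<in> \<Lambda>" if "x \<in> \<Lambda>" for x
    using diff[OF zero that] by simp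
  have add: "x + y \<in> \<Lambda>" if "x \<in> \<Lambda>" "y \<in> \<Lambda>" for x y
    using diff[OF that(1) neg[OF that(2)]] by simp
  have nat: "real k *\<^sub>R x \<in> \<Lambda>" if "x \<in> \<Lambda>" for k x
    by (induction k) (auto simp: zero scaleR_add_left intro: add that)
  have int: "of_int k *\<^sub>R x \<in> \<Lambda>" if "x \<in> \<Lambda>" for k x
  proof (cases "k \<ge> 0")
    case True
    then show ?thesis
      using nat[OF that, of "nat k"] by simp
  next
    case False
    then show ?thesis
      using neg[OF nat[OF that, of "nat (- k)"]] by simp
  qed
  show ?thesis
    using B by (induction B rule: finite_induct) (auto intro: zero add int)
qed

text \<open>Expand \<open>g\<close> in a basis taken from \<open>D\<close> and round every
  coefficient down. The error combines at most \<open>CARD('k)\<close> vectors of \<open>D\<close>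
  with coefficients in [0, 1), and each adds at most \<open>b l\<close> to coordinate
  \<open>l\<close>.\<close>

lemma lattice_point_near_span:
  fixes \<Lambda> D :: "(real^'k) set" and b :: "'k \<Rightarrow> real"
  assumes zero: "0 \<in> \<Lambda>" and diff: "\<And>x y. x \<in> \<Lambda> \<Longrightarrow> y \<in> \<Lambda> \<Longrightarrow> x - y \<in> \<Lambda>"
    and D: "D \<subseteq> \<Lambda>" "\<And>v l. v \<in> D \<Longrightarrow> \<bar>v $ l\<bar> \<le> b l" and b: "\<And>l. 0 \<le> b l"
    and g: "g \<in> span D"
  obtains z where "z \<in> \<Lambda>" "\<And>l. \<bar>g $ l - z $ l\<bar> \<le> real CARD('k) * b l"
proof -
  obtain B where B: "B \<subseteq> D" "independent B" "D \<subseteq> span B" "card B = dim D"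
    by (rule basis_exists)
  have fin: "finite B"
    using B(2) independent_bound by blast
  have card: "card B \<le> CARD('k)"
    using B(4) dim_subset_UNIV[of D] by simp
  have "g \<in> span B"
    using g B(3) span_mono[of D "span B"] by (auto simp: span_span)
  then obtain u where u: "g = (\<Sum>v\<in>B. u v *\<^sub>R v)"
    using span_finite[OF fin] by auto
  define z where "z = (\<Sum>v\<in>B. of_int \<lfloor>u v\<rfloor> *\<^sub>R v)"
  have "z \<in> \<Lambda>"
    unfolding z_def using zero diff fin B(1) D(1) by (intro add_subgroup_int_combination) auto
  moreover have "\<bar>g $ l - z $ l\<bar> \<le> real CARD('k) * b l" for l
  proof -
    have "g $ l - z $ l = (\<Sum>v\<in>B. frac (u v) * v $ l)"
      by (simp add: u z_def frac_def sum_subtractf left_diff_distrib)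
    also have "\<bar>\<dots>\<bar> \<le> (\<Sum>v\<in>B. \<bar>frac (u v) * v $ l\<bar>)"
      by (rule sum_abs)
    also have "\<dots> \<le> (\<Sum>v\<in>B. b l)"
    proof (intro sum_mono)
      fix v assume "v \<in> B"
      then have "\<bar>v $ l\<bar> \<le> b l"
        using B(1) D(2) by auto
      moreover have "\<bar>frac (u v)\<bar> \<le> 1"
        using frac_ge_0[of "u v"] frac_lt_1[of "u v"] by linarith
      ultimately have "\<bar>frac (u v)\<bar> * \<bar>v $ l\<bar> \<le> 1 * b l"
        by (intro mult_mono) auto
      then show "\<bar>frac (u v) * v $ l\<bar> \<le> b l"
        by (simp add: abs_mult)
    qed
    also have "\<dots> \<le> real CARD('k) * b l"
      using card b[of l] by (simp add: mult_right_mono)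
    finally show ?thesis .
  qed
  ultimately show ?thesis
    using that by blast
qed

text \<open>Subtracting from \<open>D\<close> a lattice point \<open>z\<close> close to
  \<open>g\<close> moves it injectively into the dilated box centred at \<open>-g\<close>. In the
  factor \<open>CARD('k) + 1\<close>, the first summand pays for rounding \<open>g\<close> and the 1
  for the points of \<open>D\<close> themselves.\<close>

lemma card_le_card_translate:
  fixes \<Lambda> D :: "(real^'k) set" and b :: "'k \<Rightarrow> real"
  assumes zero: "0 \<in> \<Lambda>" and diff: "\<And>x y. x \<in> \<Lambda> \<Longrightarrow> y \<in> \<Lambda> \<Longrightarrow> x - y \<in> \<Lambda>"
    and D: "D \<subseteq> \<Lambda>" "\<And>v l. v \<in> D \<Longrightarrow> \<bar>v $ l\<bar> \<le> b l" and b: "\<And>l. 0 \<le> b l"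
    and g: "g \<in> span D"
    and fin: "finite {v \<in> \<Lambda>. \<forall>l. \<bar>v $ l + g $ l\<bar> \<le> (real CARD('k) + 1) * b l}"
  shows "card D \<le> card {v \<in> \<Lambda>. \<forall>l. \<bar>v $ l + g $ l\<bar> \<le> (real CARD('k) + 1) * b l}"
proof -
  obtain z where z: "z \<in> \<Lambda>" "\<And>l. \<bar>g $ l - z $ l\<bar> \<le> real CARD('k) * b l"
    using lattice_point_near_span[OF zero diff D b g] by metis
  have "(\<lambda>v. v - z) ` D \<subseteq> {v \<in> \<Lambda>. \<forall>l. \<bar>v $ l + g $ l\<bar> \<le> (real CARD('k) + 1) * b l}"
  proof clarsimp
    fix v assume v: "v \<in> D"
    have "\<bar>v $ l - z $ l + g $ l\<bar> \<le> (real CARD('k) + 1) * b l" for l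
    proof -
      have "\<bar>v $ l - z $ l + g $ l\<bar> \<le> b l + real CARD('k) * b l"
        using D(2)[OF v, of l] z(2)[of l] by linarith
      then show ?thesis
        by (simp add: algebra_simps)
    qed
    then show "v - z \<in> \<Lambda> \<and> (\<forall>l. \<bar>v $ l - z $ l + g $ l\<bar> \<le> (real CARD('k) + 1) * b l)"
      using v D(1) z(1) diff by auto
  qed
  then have "card ((\<lambda>v. v - z) ` D) \<le> card {v \<in> \<Lambda>. \<forall>l. \<bar>v $ l + g $ l\<bar> \<le> (real CARD('k) + 1) * b l}"
    using fin by (intro card_mono)
  moreover have "card ((\<lambda>v. v - z) ` D) = card D"
    by (intro card_image) (simp add: inj_on_def)
  ultimately show ?thesis
    by simp
qed

text \<open>The equation of the hyperplane can be solved for the coordinate with the largest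
  \<open>\<bar>w $ l\<bar> * b l\<close> without losing relative precision. Points that are close in
  the other coordinates are then close in this one too, so cells in only \<open>card I - 1\<close>
  coordinates separate \<open>D\<close>.\<close>

lemma card_hyperplane_separated_le:
  fixes D :: "(real^'k) set" and b :: "'k \<Rightarrow> real" and I :: "'k set"
  assumes b: "\<And>l. 0 < b l" and box: "\<And>v l. v \<in> D \<Longrightarrow> \<bar>v $ l\<bar> \<le> b l"
    and supp: "\<And>v l. v \<in> D \<Longrightarrow> l \<notin> I \<Longrightarrow> v $ l = 0"
    and w: "w \<noteq> 0" "\<And>l. l \<notin> I \<Longrightarrow> w $ l = 0" "\<And>v. v \<in> D \<Longrightarrow> w \<bullet> v = 0"
    and \<nu>: "1 \<le> \<nu>"
    and sep: "\<And>u v. u \<in> D \<Longrightarrow> v \<in> D \<Longrightarrow> (\<And>l. \<bar>u $ l - v $ l\<bar> \<le> b l / \<nu>) \<Longrightarrow> u = v"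
  shows "real (card D) \<le> (4 * real CARD('k) * \<nu>) ^ (card I - 1)"
proof -
  \<comment> \<open>The factor \<open>CARD('k)\<close> absorbs the sum of the errors of the other
    coordinates, so that solving for the remaining one ends at precision
    \<open>1 / \<nu>\<close>.\<close>
  define N where "N = real CARD('k) * \<nu>"
  have N1: "1 \<le> N"
  proof -
    have "1 * 1 \<le> real CARD('k) * \<nu>"
      using \<nu> by (intro mult_mono) (auto simp: Suc_le_eq)
    then show ?thesis by (simp add: N_def)
  qed
  obtain l0 where l0: "\<And>l. \<bar>w $ l\<bar> * b l \<le> \<bar>w $ l0\<bar> * b l0"
    using ex_greatest_value[of "\<lambda>l. \<bar>w $ l\<bar> * b l"] by metis
  have w0: "w $ l0 \<noteq> 0"
  proof
    assume "w $ l0 = 0"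
    then have "\<bar>w $ l\<bar> * b l \<le> 0" for l
      using l0[of l] by simp
    then have "w $ l = 0" for l
      using b[of l] by (smt (verit) mult_pos_pos)
    then show False
      using w(1) by (simp add: vec_eq_iff)
  qed
  then have "l0 \<in> I"
    using w(2) by blast
  \<comment> \<open>Coordinates outside \<open>I\<close> vanish and \<open>l0\<close> is left to the
    hyperplane equation, so neither is recorded.\<close>
  define cell where "cell v = (\<lambda>l\<in>I - {l0}. \<lfloor>v $ l * N / b l\<rfloor>)" for v :: "real^'k"
  have inj: "inj_on cell D"
  proof (rule inj_onI)
    fix u v assume uv: "u \<in> D" "v \<in> D" "cell u = cell v"
    have close: "\<bar>u $ l - v $ l\<bar> \<le> b l / N" if "l \<noteq> l0" for l
    proof (cases "l \<in> I")
      case True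
      then have "\<lfloor>u $ l * N / b l\<rfloor> = \<lfloor>v $ l * N / b l\<rfloor>"
        using fun_cong[OF uv(3), of l] that by (simp add: cell_def)
      then have "\<bar>u $ l * N / b l - v $ l * N / b l\<bar> \<le> 1"
        by linarith
      also have "u $ l * N / b l - v $ l * N / b l = (u $ l - v $ l) * (N / b l)"
        by (simp add: left_diff_distrib diff_divide_distrib)
      finally have "\<bar>u $ l - v $ l\<bar> * (N / b l) \<le> 1"
        using N1 b[of l] by (simp add: abs_mult)
      then show ?thesis
        using N1 b[of l] by (simp add: field_simps)
    next
      case False
      then show ?thesis
        using supp uv b[of l] N1 by simp
    qed
    have "\<bar>u $ l0 - v $ l0\<bar> \<le> b l0 / \<nu>"
    proof -
      have "(\<Sum>l\<in>UNIV. w $ l * (u $ l - v $ l)) = 0"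
        using w(3)[OF uv(1)] w(3)[OF uv(2)]
        by (simp add: inner_vec_def right_diff_distrib sum_subtractf)
      then have "w $ l0 * (u $ l0 - v $ l0) = - (\<Sum>l\<in>UNIV - {l0}. w $ l * (u $ l - v $ l))"
        by (simp add: sum.remove[of UNIV l0])
      then have "\<bar>w $ l0\<bar> * \<bar>u $ l0 - v $ l0\<bar> \<le> (\<Sum>l\<in>UNIV - {l0}. \<bar>w $ l * (u $ l - v $ l)\<bar>)"
        using sum_abs[of "\<lambda>l. w $ l * (u $ l - v $ l)" "UNIV - {l0}"]
        by (simp flip: abs_mult)
      also have "\<dots> \<le> (\<Sum>l\<in>UNIV - {l0}. \<bar>w $ l0\<bar> * b l0 / N)"
      proof (intro sum_mono)
        fix l assume "l \<in> UNIV - {l0}"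
        then have "\<bar>w $ l\<bar> * \<bar>u $ l - v $ l\<bar> \<le> \<bar>w $ l\<bar> * (b l / N)"
          using close by (intro mult_left_mono) auto
        also have "\<dots> \<le> \<bar>w $ l0\<bar> * b l0 / N"
          using l0[of l] N1 by (simp add: divide_right_mono)
        finally show "\<bar>w $ l * (u $ l - v $ l)\<bar> \<le> \<bar>w $ l0\<bar> * b l0 / N"
          by (simp add: abs_mult)
      qed
      also have "\<dots> \<le> real CARD('k) * (\<bar>w $ l0\<bar> * b l0 / N)"
        unfolding sum_constant using N1 b[of l0] by (intro mult_right_mono) (auto simp: card_Diff_singleton)
      also have "\<dots> = \<bar>w $ l0\<bar> * (b l0 / \<nu>)"
        by (simp add: N_def)
      finally have "\<bar>w $ l0\<bar> * \<bar>u $ l0 - v $ l0\<bar> \<le> \<bar>w $ l0\<bar> * (b l0 / \<nu>)" .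
      then show ?thesis
        by (rule mult_left_le_imp_le) (simp add: w0)
    qed
    moreover have "b l / N \<le> b l / \<nu>" for l
    proof -
      have "\<nu> \<le> N"
        using \<nu> by (simp add: N_def Suc_le_eq)
      then show ?thesis
        using \<nu> b[of l] by (intro divide_left_mono) auto
    qed
    ultimately have "\<bar>u $ l - v $ l\<bar> \<le> b l / \<nu>" for l
      using close order_trans by (cases "l = l0") blast+
    then show "u = v"
      using sep uv by blast
  qed
  have "cell ` D \<subseteq> PiE (I - {l0}) (\<lambda>_. {\<lfloor>- N\<rfloor>..\<lfloor>N\<rfloor>})"
  proof clarsimp
    fix v assume v: "v \<in> D"
    have "\<lfloor>- N\<rfloor> \<le> \<lfloor>v $ l * N / b l\<rfloor> \<and> \<lfloor>v $ l * N / b l\<rfloor> \<le> \<lfloor>N\<rfloor>" for l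
    proof -
      define t where "t = v $ l * N / b l"
      have "\<bar>t\<bar> = (\<bar>v $ l\<bar> / b l) * N"
        using b[of l] N1 by (simp add: t_def abs_mult)
      also have "\<dots> \<le> 1 * N"
        using box[OF v, of l] b[of l] N1 by (intro mult_right_mono) auto
      finally show ?thesis
        unfolding t_def[symmetric] by (intro conjI floor_mono) linarith+
    qed
    then show "cell v \<in> PiE (I - {l0}) (\<lambda>_. {\<lfloor>- N\<rfloor>..\<lfloor>N\<rfloor>})"
      by (auto simp: cell_def)
  qed
  then have "card D \<le> card (PiE (I - {l0}) (\<lambda>_. {\<lfloor>- N\<rfloor>..\<lfloor>N\<rfloor>}))"
    using inj by (intro card_inj_on_le[of cell]) (auto intro: finite_PiE)
  also have "\<dots> = card {\<lfloor>- N\<rfloor>..\<lfloor>N\<rfloor>} ^ (card I - 1)"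
    using \<open>l0 \<in> I\<close> by (simp add: card_PiE card_Diff_singleton)
  finally have "real (card D) \<le> real (card {\<lfloor>- N\<rfloor>..\<lfloor>N\<rfloor>}) ^ (card I - 1)"
    by (metis of_nat_le_iff of_nat_power)
  also have "\<dots> \<le> (4 * N) ^ (card I - 1)"
  proof (intro power_mono)
    \<comment> \<open>The interval holds at most \<open>2 * N + 2\<close> integers, which is at most
      \<open>4 * N\<close> because \<open>1 \<le> N\<close>.\<close>
    have "real_of_int (\<lfloor>N\<rfloor> + 1 - \<lfloor>- N\<rfloor>) \<le> 4 * N"
      using N1 by linarith
    then show "real (card {\<lfloor>- N\<rfloor>..\<lfloor>N\<rfloor>}) \<le> 4 * N"
      using N1 by (simp add: of_nat_nat)
  qed simp
  finally show ?thesis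
    by (simp add: N_def mult.assoc)
qed

text \<open>Counting in one fixed translate would give factors \<open>2 * A i + 1\<close>, which are
  too large for small \<open>A i\<close>. The mean over translates has no such loss, and some
  translate does no worse than the mean.\<close>

lemma ex_translate_few_points:
  fixes x :: "'q \<Rightarrow> real^'m" and A :: "'m \<Rightarrow> real"
  assumes Q: "finite Q" and A: "\<And>i. 0 < A i"
  obtains s :: "real^'m" where
    "finite {(p :: int^'m, q). q \<in> Q \<and> (\<forall>i. \<bar>x q $ i + of_int (p $ i) + s $ i\<bar> \<le> A i)}"
    "real (card {(p :: int^'m, q). q \<in> Q \<and> (\<forall>i. \<bar>x q $ i + of_int (p $ i) + s $ i\<bar> \<le> A i)})
      \<le> real (card Q) * (\<Prod>i\<in>UNIV. 3 * A i)"
proof -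
  \<comment> \<open>Average over the translates by the grid $(K^{-1}\mathbb{Z}/\mathbb{Z})^m$ for $K$ large.\<close>
  obtain i0 where i0: "\<And>i. 1 / A i \<le> 1 / A i0"
    using ex_greatest_value[of "\<lambda>i. 1 / A i"] by metis
  define K where "K = nat \<lceil>1 / A i0\<rceil>"
  have "0 < 1 / A i0"
    using A by simp
  then have K0: "0 < K"
    by (simp add: K_def)
  \<comment> \<open>Source of the factor 3: once \<open>K * A i\<close> is at least 1, the bound
    \<open>2 * K * A i + 1\<close> for the scaled interval is at most
    \<open>3 * K * A i\<close>.\<close>
  have KA: "1 \<le> real K * A i" for i
  proof -
    have "1 / A i \<le> real K"
      using i0[of i] by (simp add: K_def) linarith
    then show ?thesis
      using A[of i] by (simp add: field_simps)
  qed
  define G where "G = {t :: int^'m. \<forall>i. t $ i \<in> {0..<int K}}"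
  define F where "F t = {(p :: int^'m, q). q \<in> Q \<and>
    (\<forall>i. \<bar>x q $ i + of_int (p $ i) + of_int (t $ i) / real K\<bar> \<le> A i)}" for t :: "int^'m"
  have G: "finite G" "card G = K ^ CARD('m)"
    unfolding G_def by (simp_all add: card_vec_box del: atLeastLessThan_iff)
  define H where "H q = {z :: int^'m. \<forall>i. \<bar>real K * x q $ i + of_int (z $ i)\<bar> \<le> real K * A i}" for q
  have H: "finite (H q)" "real (card (H q)) \<le> (\<Prod>i\<in>UNIV. real K * (3 * A i))" for q
  proof -
    show "finite (H q)"
      unfolding H_def using A by (intro card_int_vec_near) (simp add: less_imp_le)
    have "real (card (H q)) \<le> (\<Prod>i\<in>UNIV. 2 * (real K * A i) + 1)"
      unfolding H_def using A by (intro card_int_vec_near) (simp add: less_imp_le)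
    also have "\<dots> \<le> (\<Prod>i\<in>UNIV. real K * (3 * A i))"
    proof (intro prod_mono conjI)
      show "2 * (real K * A i) + 1 \<le> real K * (3 * A i)" for i
        using KA[of i] by (simp add: algebra_simps)
      show "0 \<le> 2 * (real K * A i) + 1" for i
        using KA[of i] by linarith
    qed
    finally show "real (card (H q)) \<le> (\<Prod>i\<in>UNIV. real K * (3 * A i))" .
  qed
  \<comment> \<open>\<open>p\<close> and \<open>t\<close> are quotient and remainder of the vector
    \<open>K * p + t\<close> modulo \<open>K\<close>, so pairs of a translate and a point in it
    inject into the integer points of boxes scaled by \<open>K\<close>.\<close>
  define h where "h = (\<lambda>(t :: int^'m, p :: int^'m, q :: 'q). (q, \<chi> i. int K * p $ i + t $ i))"
  have inj: "inj_on h (SIGMA t:G. F t)"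
  proof (rule inj_onI)
    fix y y' assume "y \<in> (SIGMA t:G. F t)" "y' \<in> (SIGMA t:G. F t)" and eq: "h y = h y'"
    then obtain t p q t' p' q' where t: "t \<in> G" "t' \<in> G" and y: "y = (t, p, q)" "y' = (t', p', q')"
      by auto
    have e: "int K * p $ i + t $ i = int K * p' $ i + t' $ i" for i
      using eq by (simp add: y h_def vec_eq_iff)
    have "t $ i = t' $ i" for i
    proof -
      have "(int K * p $ i + t $ i) mod int K = (int K * p' $ i + t' $ i) mod int K"
        using e by simp
      then show ?thesis
        using t by (simp add: G_def)
    qed
    then show "y = y'"
      using e K0 eq by (simp add: y h_def vec_eq_iff)
  qed
  have sub: "h ` (SIGMA t:G. F t) \<subseteq> (SIGMA q:Q. H q)"
  proof (clarsimp simp: h_def F_def H_def)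
    fix t p :: "int^'m" and q i
    assume "\<forall>i. \<bar>x q $ i + of_int (p $ i) + of_int (t $ i) / real K\<bar> \<le> A i"
    then have "real K * \<bar>x q $ i + of_int (p $ i) + of_int (t $ i) / real K\<bar> \<le> real K * A i"
      by (intro mult_left_mono) auto
    also have "real K * \<bar>x q $ i + of_int (p $ i) + of_int (t $ i) / real K\<bar>
      = \<bar>real K * (x q $ i + of_int (p $ i) + of_int (t $ i) / real K)\<bar>"
      by (simp add: abs_mult)
    also have "real K * (x q $ i + of_int (p $ i) + of_int (t $ i) / real K)
      = real K * x q $ i + (real K * of_int (p $ i) + of_int (t $ i))"
      using K0 by (simp add: field_simps)
    finally show "\<bar>real K * x q $ i + (real K * of_int (p $ i) + of_int (t $ i))\<bar> \<le> real K * A i" .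
  qed
  have finQH: "finite (SIGMA q:Q. H q)"
    using Q H by auto
  then have finGF: "finite (SIGMA t:G. F t)"
    using inj sub by (metis finite_imageD finite_subset)
  have finF: "finite (F t)" if "t \<in> G" for t
  proof -
    have "F t \<subseteq> snd ` (SIGMA t:G. F t)"
      using that by force
    then show ?thesis
      using finGF finite_subset by blast
  qed
  have "(\<Sum>t\<in>G. real (card (F t))) = real (card (SIGMA t:G. F t))"
    using G finF by simp
  also have "\<dots> \<le> real (card (SIGMA q:Q. H q))"
    using card_inj_on_le[OF inj sub finQH] by simp
  also have "\<dots> = (\<Sum>q\<in>Q. real (card (H q)))"
    using Q H by simp
  also have "\<dots> \<le> (\<Sum>q\<in>Q. (\<Prod>i\<in>UNIV. real K * (3 * A i)))"
    by (intro sum_mono H)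
  also have "\<dots> = real (card G) * (real (card Q) * (\<Prod>i\<in>UNIV. 3 * A i))"
    by (simp add: G prod.distrib)
  finally have le: "(\<Sum>t\<in>G. real (card (F t))) \<le> (\<Sum>t\<in>G. real (card Q) * (\<Prod>i\<in>UNIV. 3 * A i))"
    by simp
  have "G \<noteq> {}"
    using G K0 by (metis card.empty power_not_zero less_irrefl)
  then obtain t where t: "t \<in> G" "real (card (F t)) \<le> real (card Q) * (\<Prod>i\<in>UNIV. 3 * A i)"
    using le sum_strict_mono[OF G(1), of "\<lambda>_. real (card Q) * (\<Prod>i\<in>UNIV. 3 * A i)" "\<lambda>t. real (card (F t))"]
    by (meson not_le)
  then show ?thesis
    using that[of "\<chi> i. of_int (t $ i) / real K"] finF[of t] by (simp add: F_def)
qed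

section \<open>Lattice points in a single box\<close>

text \<open>The unimodular lattice attached to \<open>L\<close>: the \<open>Inl\<close> coordinates
  measure the quality of approximation, the \<open>Inr\<close> coordinates the height.\<close>

definition lattice_vec :: "real^'n^'m \<Rightarrow> int^'m \<Rightarrow> int^'n \<Rightarrow> real^('m + 'n)" where
  "lattice_vec L p q = (\<chi> l. case l of Inl i \<Rightarrow> row_app L i q + of_int (p $ i) | Inr j \<Rightarrow> of_int (q $ j))"

lemma lattice_vec_nth [simp]:
  "lattice_vec L p q $ Inl i = row_app L i q + of_int (p $ i)"
  "lattice_vec L p q $ Inr j = of_int (q $ j)"
  by (simp_all add: lattice_vec_def)

lemma row_app_diff: "row_app L i (q - q') = row_app L i q - row_app L i q'"
  by (simp add: row_app_def right_diff_distrib sum_subtractf)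

lemma vec_sum_eq_iff: "u = v \<longleftrightarrow> (\<forall>i. u $ Inl i = v $ Inl i) \<and> (\<forall>j. u $ Inr j = v $ Inr j)"
  for u v :: "'a^('m::finite + 'n::finite)"
  unfolding vec_eq_iff by (metis sum.exhaust)

lemma lattice_vec_diff:
  "lattice_vec L p q - lattice_vec L p' q' = lattice_vec L (p - p') (q - q')"
  by (simp add: vec_sum_eq_iff row_app_diff)

lemma lattice_vec_inject: "lattice_vec L p q = lattice_vec L p' q' \<longleftrightarrow> p = p' \<and> q = q'"
proof
  assume eq: "lattice_vec L p q = lattice_vec L p' q'"
  then have "q = q'"
    by (simp add: vec_sum_eq_iff vec_eq_iff[of q])
  then show "p = p' \<and> q = q'"
    using eq by (simp add: vec_sum_eq_iff vec_eq_iff[of p])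
qed simp

lemma dist_int_nonneg [simp]: "0 \<le> dist_int x"
  by (simp add: dist_int_def)

lemma dist_int_le: "dist_int x \<le> \<bar>x + of_int k\<bar>"
  using round_diff_minimal[of x "- k"] by (simp add: dist_int_def)

lemma prod_le_const_times:
  fixes f g :: "'a \<Rightarrow> real"
  assumes "finite A" "\<And>i. i \<in> A \<Longrightarrow> 0 \<le> f i \<and> f i \<le> c * g i"
  shows "prod f A \<le> c ^ card A * prod g A"
  using prod_mono[of A f "\<lambda>i. c * g i"] assms by (simp add: prod.distrib)

text \<open>Every shift of the \<open>Inl\<close> coordinates, extended by zero, lies in
  \<open>span D\<close>, so \<open>D\<close> has no more points than any such translate of the
  dilated box, in particular one that averaging makes small. In \<open>6 * (k + 1)\<close>, 2 comes
  from taking differences, 3 from averaging and \<open>k + 1\<close> from the dilation.\<close>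

lemma card_slice_full_span:
  fixes L :: "real^'n^'m" and a :: "'m \<Rightarrow> real" and T :: "real^'n" and J :: "'n set"
  defines "k \<equiv> CARD('m) + CARD('n)"
  assumes a: "\<And>i. 0 < a i" and T: "\<And>j. 1 \<le> T $ j"
    and D: "D \<subseteq> {lattice_vec L p q |p q. \<forall>j. j \<notin> J \<longrightarrow> q $ j = 0}"
    and box: "\<And>v i. v \<in> D \<Longrightarrow> \<bar>v $ Inl i\<bar> \<le> 2 * a i" "\<And>v j. v \<in> D \<Longrightarrow> \<bar>v $ Inr j\<bar> \<le> 2 * T $ j"
    and full: "{v :: real^('m + 'n). \<forall>j. j \<notin> J \<longrightarrow> v $ Inr j = 0} \<subseteq> span D"
  shows "real (card D) \<le> (6 * (real k + 1)) ^ k * ((\<Prod>i\<in>UNIV. a i) * (\<Prod>j\<in>J. T $ j))"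
proof -
  define c where "c = 6 * (real k + 1)"
  have c1: "1 \<le> c"
    by (simp add: c_def)
  have ck: "card (UNIV :: ('m + 'n) set) = k"
    by (simp add: k_def)
  define \<Lambda> where "\<Lambda> = {lattice_vec L p q |p q. \<forall>j. j \<notin> J \<longrightarrow> q $ j = 0}"
  define b where "b l = (case l of Inl i \<Rightarrow> 2 * a i | Inr j \<Rightarrow> 2 * T $ j)" for l :: "'m + 'n"
  have T0: "0 < T $ j" for j
    using T[of j] by linarith
  \<comment> \<open>Width 0 outside \<open>J\<close> leaves only the integer 0 there, so these
    coordinates contribute no factor \<open>T $ j\<close>.\<close>
  define Q where "Q = {q :: int^'n. \<forall>j. \<bar>0 + of_int (q $ j)\<bar> \<le> (if j \<in> J then (real k + 1) * (2 * T $ j) else 0)}"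
  have Q: "finite Q" "real (card Q) \<le> c ^ CARD('n) * (\<Prod>j\<in>J. T $ j)"
  proof -
    have nn: "0 \<le> (if j \<in> J then (real k + 1) * (2 * T $ j) else 0)" for j
      using T0[of j] by simp
    show "finite Q"
      unfolding Q_def by (rule card_int_vec_near(1)[OF nn])
    have "real (card Q) \<le> (\<Prod>j\<in>UNIV. 2 * (if j \<in> J then (real k + 1) * (2 * T $ j) else 0) + 1)"
      unfolding Q_def by (rule card_int_vec_near(2)[OF nn])
    also have "\<dots> \<le> c ^ CARD('n) * (\<Prod>j\<in>UNIV. if j \<in> J then T $ j else 1)"
    proof (intro prod_le_const_times conjI)
      fix j
      have "1 * 1 \<le> (real k + 1) * T $ j"
        using T[of j] by (intro mult_mono) auto
      then have "2 * ((real k + 1) * (2 * T $ j)) + 1 \<le> c * T $ j"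
        unfolding c_def by linarith
      then show "2 * (if j \<in> J then (real k + 1) * (2 * T $ j) else 0) + 1 \<le> c * (if j \<in> J then T $ j else 1)"
        using c1 by simp
      show "0 \<le> 2 * (if j \<in> J then (real k + 1) * (2 * T $ j) else 0) + 1"
        using nn[of j] by linarith
    qed simp
    also have "(\<Prod>j\<in>UNIV. if j \<in> J then T $ j else 1) = (\<Prod>j\<in>J. T $ j)"
      by (simp add: prod.If_cases)
    finally show "real (card Q) \<le> c ^ CARD('n) * (\<Prod>j\<in>J. T $ j)" .
  qed
  define x where "x q = (\<chi> i. row_app L i q)" for q :: "int^'n"
  obtain s :: "real^'m" where s:
    "finite {(p :: int^'m, q). q \<in> Q \<and> (\<forall>i. \<bar>x q $ i + of_int (p $ i) + s $ i\<bar> \<le> (real k + 1) * (2 * a i))}"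
    "real (card {(p :: int^'m, q). q \<in> Q \<and> (\<forall>i. \<bar>x q $ i + of_int (p $ i) + s $ i\<bar> \<le> (real k + 1) * (2 * a i))})
      \<le> real (card Q) * (\<Prod>i\<in>UNIV. 3 * ((real k + 1) * (2 * a i)))"
    by (rule ex_translate_few_points[OF Q(1), where A = "\<lambda>i. (real k + 1) * (2 * a i)" and x = x])
      (simp add: a)
  define P where "P = {(p :: int^'m, q). q \<in> Q \<and> (\<forall>i. \<bar>x q $ i + of_int (p $ i) + s $ i\<bar> \<le> (real k + 1) * (2 * a i))}"
  \<comment> \<open>Only the \<open>Inl\<close> coordinates are shifted: as each
    \<open>T $ j\<close> is at least 1, counting the \<open>q\<close> directly costs just a constant
    factor.\<close>
  define g :: "real^('m + 'n)" where "g = (\<chi> l. case l of Inl i \<Rightarrow> s $ i | Inr j \<Rightarrow> 0)"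
  define N where "N = {v \<in> \<Lambda>. \<forall>l. \<bar>v $ l + g $ l\<bar> \<le> (real CARD('m + 'n) + 1) * b l}"
  have sub: "N \<subseteq> (\<lambda>(p, q). lattice_vec L p q) ` P"
  proof
    fix v assume v: "v \<in> N"
    then obtain p q where pq: "v = lattice_vec L p q" "\<And>j. j \<notin> J \<Longrightarrow> q $ j = 0"
      by (auto simp: N_def \<Lambda>_def)
    have le: "\<bar>v $ l + g $ l\<bar> \<le> (real k + 1) * b l" for l
      using v unfolding N_def ck by simp
    have "q \<in> Q"
      unfolding Q_def using le[of "Inr _"] pq by (simp add: g_def b_def)
    moreover have "\<bar>x q $ i + of_int (p $ i) + s $ i\<bar> \<le> (real k + 1) * (2 * a i)" for i
      using le[of "Inl i"] pq by (simp add: g_def b_def x_def)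
    ultimately show "v \<in> (\<lambda>(p, q). lattice_vec L p q) ` P"
      using pq by (auto simp: P_def)
  qed
  have finN: "finite N"
    using sub s(1) finite_subset unfolding P_def by blast
  have "card D \<le> card N"
    unfolding N_def
  proof (rule card_le_card_translate)
    show "0 \<in> \<Lambda>"
      unfolding \<Lambda>_def by (rule CollectI, rule exI[of _ 0], rule exI[of _ 0])
        (simp add: vec_sum_eq_iff row_app_def)
    show "u - v \<in> \<Lambda>" if uv: "u \<in> \<Lambda>" "v \<in> \<Lambda>" for u v
    proof -
      obtain p q p' q' where "u = lattice_vec L p q" "\<forall>j. j \<notin> J \<longrightarrow> q $ j = 0"
        "v = lattice_vec L p' q'" "\<forall>j. j \<notin> J \<longrightarrow> q' $ j = 0"
        using uv unfolding \<Lambda>_def by blast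
      then show ?thesis
        unfolding \<Lambda>_def
        by (intro CollectI exI[of _ "p - p'"] exI[of _ "q - q'"]) (simp add: lattice_vec_diff)
    qed
    show "D \<subseteq> \<Lambda>"
      using D by (simp add: \<Lambda>_def)
    show "\<bar>v $ l\<bar> \<le> b l" if "v \<in> D" for v l
      using box that by (cases l) (auto simp: b_def)
    show "0 \<le> b l" for l
      using a T0 by (cases l) (auto simp: b_def less_imp_le)
    show "g \<in> span D"
      using full by (auto simp: g_def)
    show "finite {v \<in> \<Lambda>. \<forall>l. \<bar>v $ l + g $ l\<bar> \<le> (real CARD('m + 'n) + 1) * b l}"
      using finN by (simp add: N_def)
  qed
  also have "card N \<le> card P"
    using sub s(1) surj_card_le unfolding P_def by blast
  finally have "real (card D) \<le> real (card P)"
    by simp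
  also have "\<dots> \<le> real (card Q) * (\<Prod>i\<in>UNIV. c * a i)"
    using s(2) by (simp add: P_def c_def algebra_simps)
  also have "\<dots> \<le> (c ^ CARD('n) * (\<Prod>j\<in>J. T $ j)) * (\<Prod>i\<in>UNIV. c * a i)"
    using Q(2) a c1 by (intro mult_right_mono prod_nonneg) (auto simp: less_imp_le)
  also have "\<dots> = c ^ k * ((\<Prod>i\<in>UNIV. a i) * (\<Prod>j\<in>J. T $ j))"
    by (simp add: prod.distrib k_def power_add)
  finally show ?thesis
    by (simp add: c_def)
qed

text \<open>Two points of \<open>D\<close> in one cell would differ by a lattice vector with nonzero
  integer part and sides at most \<open>a i / (2 * \<mu>)\<close> and \<open>T $ j / \<mu>\<close>.
  The equation for \<open>\<mu>\<close> makes the product of these sides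
  \<open>\<phi>0 / 2 ^ CARD('m)\<close>, which contradicts bad approximability.\<close>

lemma card_slice_hyperplane:
  fixes L :: "real^'n^'m" and a :: "'m \<Rightarrow> real" and T :: "real^'n" and J :: "'n set"
    and \<phi>0 \<mu> :: real
  defines "k \<equiv> CARD('m) + CARD('n)"
  assumes a: "\<And>i. 0 < a i" and T: "\<And>j. 1 \<le> T $ j" and \<phi>0: "0 < \<phi>0"
    and bad: "\<And>q :: int^'n. q \<noteq> 0 \<Longrightarrow> (\<And>j. \<bar>real_of_int (q $ j)\<bar> \<le> T $ j) \<Longrightarrow>
      \<phi>0 \<le> (\<Prod>j\<in>UNIV. plus1 \<bar>of_int (q $ j)\<bar>) * (\<Prod>i\<in>UNIV. dist_int (row_app L i q))"
    and \<mu>: "1 \<le> \<mu>" "\<And>j. j \<in> J \<Longrightarrow> \<mu> \<le> T $ j"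
      "\<mu> ^ (CARD('m) + card J) = (\<Prod>i\<in>UNIV. a i) * (\<Prod>j\<in>J. T $ j) / \<phi>0"
    and D: "D \<subseteq> {lattice_vec L p q |p q. \<forall>j. j \<notin> J \<longrightarrow> q $ j = 0}"
    and inj: "\<And>p p' q. lattice_vec L p q \<in> D \<Longrightarrow> lattice_vec L p' q \<in> D \<Longrightarrow> p = p'"
    and box: "\<And>v i. v \<in> D \<Longrightarrow> \<bar>v $ Inl i\<bar> \<le> 2 * a i" "\<And>v j. v \<in> D \<Longrightarrow> \<bar>v $ Inr j\<bar> \<le> 2 * T $ j"
    and thin: "\<not> {v :: real^('m + 'n). \<forall>j. j \<notin> J \<longrightarrow> v $ Inr j = 0} \<subseteq> span D"
  shows "real (card D) \<le> (16 * real k * \<mu>) ^ (CARD('m) + card J - 1)"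
proof -
  define V where "V = {v :: real^('m + 'n). \<forall>j. j \<notin> J \<longrightarrow> v $ Inr j = 0}"
  have "subspace V"
    unfolding V_def by (auto simp: subspace_def)
  then have spanV: "span V = V"
    by (simp add: span_eq_iff)
  have DV: "D \<subseteq> V"
    using D by (auto simp: V_def)
  have T0: "0 < T $ j" for j
    using T[of j] by linarith
  have ck: "card (UNIV :: ('m + 'n) set) = k"
    by (simp add: k_def)
  \<comment> \<open>The normal vector is sought inside \<open>V\<close>, so that the relation it
    gives involves only the coordinates in \<open>I\<close>.\<close>
  have "span D \<subset> span V"
    using thin span_mono[OF DV] unfolding spanV by (auto simp: V_def)
  then obtain w where w: "w \<noteq> 0" "w \<in> span V" "\<And>y. y \<in> span D \<Longrightarrow> orthogonal w y"
    by (rule orthogonal_to_subspace_exists_gen) blast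
  define b where "b l = (case l of Inl i \<Rightarrow> 2 * a i | Inr j \<Rightarrow> 2 * T $ j)" for l :: "'m + 'n"
  define I :: "('m + 'n) set" where "I = range Inl \<union> Inr ` J"
  have notI: "l \<notin> I \<longleftrightarrow> (\<exists>j. j \<notin> J \<and> l = Inr j)" for l :: "'m + 'n"
    by (cases l) (auto simp: I_def)
  have cI: "card I = CARD('m) + card J"
    unfolding I_def by (subst card_Un_disjoint) (auto simp: card_image)
  have "real (card D) \<le> (4 * real CARD('m + 'n) * (4 * \<mu>)) ^ (card I - 1)"
  proof (rule card_hyperplane_separated_le[where b = b and w = w])
    show "0 < b l" for l
      using a T0 by (cases l) (auto simp: b_def)
    show "\<bar>v $ l\<bar> \<le> b l" if "v \<in> D" for v l
      using box that by (cases l) (auto simp: b_def)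
    show "v $ l = 0" if "v \<in> D" "l \<notin> I" for v l
      using that DV by (auto simp: notI V_def)
    show "w $ l = 0" if "l \<notin> I" for l
      using that w(2) unfolding spanV by (auto simp: notI V_def)
    show "w \<bullet> v = 0" if "v \<in> D" for v
      using w(3) span_base[OF that] by (simp add: orthogonal_def)
    show "w \<noteq> 0" "1 \<le> 4 * \<mu>"
      using w(1) \<mu>(1) by auto
    show "u = v" if uv: "u \<in> D" "v \<in> D" and close: "\<And>l. \<bar>u $ l - v $ l\<bar> \<le> b l / (4 * \<mu>)" for u v
    proof (rule ccontr)
      assume "u \<noteq> v"
      obtain p q p' q' where u: "u = lattice_vec L p q" "\<forall>j. j \<notin> J \<longrightarrow> q $ j = 0"
        and v: "v = lattice_vec L p' q'" "\<forall>j. j \<notin> J \<longrightarrow> q' $ j = 0"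
        using uv D by blast
      define r where "r = q - q'"
      \<comment> \<open>With \<open>r = 0\<close> both points would share \<open>q\<close>, hence by
        \<open>inj\<close> also \<open>p\<close>, and would coincide.\<close>
      have "r \<noteq> 0"
        using \<open>u \<noteq> v\<close> inj uv unfolding u v r_def by auto
      have r0: "r $ j = 0" if "j \<notin> J" for j
        using that u v by (simp add: r_def)
      have rle: "\<bar>real_of_int (r $ j)\<bar> \<le> T $ j / \<mu>" for j
      proof -
        have "\<bar>real_of_int (r $ j)\<bar> \<le> T $ j / (2 * \<mu>)"
          using close[of "Inr j"] \<mu>(1) by (simp add: u v r_def b_def field_simps)
        also have "\<dots> \<le> T $ j / \<mu>"
          using \<mu>(1) T0[of j] by (simp add: field_simps)
        finally show ?thesis .
      qed
      have "\<bar>real_of_int (r $ j)\<bar> \<le> T $ j" for j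
      proof -
        have "T $ j * 1 \<le> T $ j * \<mu>"
          using \<mu>(1) T0[of j] by (intro mult_left_mono) auto
        then have "T $ j / \<mu> \<le> T $ j"
          using \<mu>(1) by (simp add: field_simps)
        then show ?thesis
          using rle[of j] by linarith
      qed
      then have "\<phi>0 \<le> (\<Prod>j\<in>UNIV. plus1 \<bar>of_int (r $ j)\<bar>) * (\<Prod>i\<in>UNIV. dist_int (row_app L i r))"
        using bad \<open>r \<noteq> 0\<close> by blast
      also have "\<dots> \<le> (\<Prod>j\<in>J. T $ j / \<mu>) * (\<Prod>i\<in>UNIV. a i / (2 * \<mu>))"
      proof (intro mult_mono)
        \<comment> \<open>On \<open>J\<close> the bound \<open>T $ j / \<mu>\<close> is at least 1,
          so the truncation in \<open>plus1\<close> does not spoil it; off \<open>J\<close> the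
          entry is 0 and the factor is 1.\<close>
        have "(\<Prod>j\<in>UNIV. plus1 \<bar>of_int (r $ j)\<bar>) \<le> (\<Prod>j\<in>UNIV. if j \<in> J then T $ j / \<mu> else 1)"
        proof (intro prod_mono conjI)
          show "plus1 \<bar>of_int (r $ j)\<bar> \<le> (if j \<in> J then T $ j / \<mu> else 1)" for j
            using rle[of j] r0[of j] \<mu> by (auto simp: plus1_def)
        qed (simp add: plus1_def)
        also have "\<dots> = (\<Prod>j\<in>J. T $ j / \<mu>)"
          by (simp add: prod.If_cases)
        finally show "(\<Prod>j\<in>UNIV. plus1 \<bar>of_int (r $ j)\<bar>) \<le> (\<Prod>j\<in>J. T $ j / \<mu>)" .
        show "(\<Prod>i\<in>UNIV. dist_int (row_app L i r)) \<le> (\<Prod>i\<in>UNIV. a i / (2 * \<mu>))"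
        proof (intro prod_mono conjI)
          fix i
          have "dist_int (row_app L i r) \<le> \<bar>row_app L i r + of_int (p $ i - p' $ i)\<bar>"
            by (rule dist_int_le)
          also have "\<dots> \<le> a i / (2 * \<mu>)"
            using close[of "Inl i"] \<mu>(1)
            by (simp add: u v r_def b_def row_app_diff field_simps)
          finally show "dist_int (row_app L i r) \<le> a i / (2 * \<mu>)" .
        qed (simp add: dist_int_def)
        show "0 \<le> (\<Prod>i\<in>UNIV. dist_int (row_app L i r))"
          by (intro prod_nonneg) (simp add: dist_int_def)
        show "0 \<le> (\<Prod>j\<in>J. T $ j / \<mu>)"
          using T0 \<mu>(1) by (intro prod_nonneg) (simp add: less_imp_le)
      qed
      also have "\<dots> = (\<Prod>i\<in>UNIV. a i) * (\<Prod>j\<in>J. T $ j) / \<mu> ^ (CARD('m) + card J) / 2 ^ CARD('m)"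
        by (simp add: prod_dividef power_add power_mult_distrib mult_ac)
      also have "\<dots> = \<phi>0 / 2 ^ CARD('m)"
      proof -
        have "z / (z / \<phi>0) = \<phi>0" if "0 < z" for z
          using that \<phi>0 by simp
        moreover have "0 < (\<Prod>i\<in>UNIV. a i) * (\<Prod>j\<in>J. T $ j)"
          using a T0 by (intro mult_pos_pos prod_pos) auto
        ultimately show ?thesis
          unfolding \<mu>(3) by metis
      qed
      also have "\<dots> < \<phi>0"
        using \<phi>0 by (simp add: field_simps)
      finally show False
        by simp
    qed
  qed
  then show ?thesis
    unfolding ck cI by (simp add: mult_ac)
qed

text \<open>The count is split into slices by the coordinates outside a set \<open>J\<close>. On
  each slice the full-span case gives a volume term and the hyperplane case a power of
  \<open>\<mu>\<close>; multiplying by the number of slices eliminates \<open>J\<close> from the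
  bound.\<close>

lemma card_box_le:
  fixes L :: "real^'n^'m" and a :: "'m \<Rightarrow> real" and T :: "real^'n" and \<phi>0 :: real
  defines "k \<equiv> CARD('m) + CARD('n)"
  defines "X \<equiv> (\<Prod>i\<in>UNIV. a i) * (\<Prod>j\<in>UNIV. T $ j)"
  assumes a: "\<And>i. 0 < a i" and T: "\<And>j. 1 \<le> T $ j" and \<phi>0: "0 < \<phi>0"
    and bad: "\<And>q :: int^'n. q \<noteq> 0 \<Longrightarrow> (\<And>j. \<bar>real_of_int (q $ j)\<bar> \<le> T $ j) \<Longrightarrow>
      \<phi>0 \<le> (\<Prod>j\<in>UNIV. plus1 \<bar>of_int (q $ j)\<bar>) * (\<Prod>i\<in>UNIV. dist_int (row_app L i q))"
    and Q: "Q \<subseteq> {q. q \<noteq> 0 \<and> (\<forall>j. \<bar>real_of_int (q $ j)\<bar> \<le> T $ j) \<and> (\<forall>i. dist_int (row_app L i q) \<le> a i)}"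
  shows "real (card Q) \<le> 3 ^ CARD('n) * (16 * real k) ^ k * (X + (X / \<phi>0) powr (real (k - 1) / real k))"
proof (cases "Q = {}")
  case True
  have "0 \<le> X"
    unfolding X_def using a T by (intro mult_nonneg_nonneg prod_nonneg) (auto intro: less_imp_le order_trans[of 0 1])
  then show ?thesis
    using True by simp
next
  case False
  have T0: "0 < T $ j" for j
    using T[of j] by linarith
  define \<alpha> where "\<alpha> = (\<Prod>i\<in>UNIV. a i)"
  have \<alpha>0: "0 < \<alpha>"
    unfolding \<alpha>_def using a by (intro prod_pos) auto
  define TJ where "TJ J = (\<Prod>j\<in>J. T $ j)" for J
  have TJ0: "0 < TJ J" for J
    unfolding TJ_def using T0 by (intro prod_pos) auto
  have X: "X = \<alpha> * TJ UNIV"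
    by (simp add: X_def \<alpha>_def TJ_def)
  have k2: "2 \<le> k"
    unfolding k_def using zero_less_card_finite[where 'a='m] zero_less_card_finite[where 'a='n] by linarith
  \<comment> \<open>Any point of the nonempty \<open>Q\<close> lets the lower bound be compared with
    the box; this later gives \<open>1 \<le> \<mu>\<close>.\<close>
  have "1 \<le> X / \<phi>0"
  proof -
    obtain q where q: "q \<noteq> 0" "\<And>j. \<bar>real_of_int (q $ j)\<bar> \<le> T $ j" "\<And>i. dist_int (row_app L i q) \<le> a i"
      using False Q by auto
    have "\<phi>0 \<le> (\<Prod>j\<in>UNIV. plus1 \<bar>of_int (q $ j)\<bar>) * (\<Prod>i\<in>UNIV. dist_int (row_app L i q))"
      by (rule bad[OF q(1,2)])
    also have "\<dots> \<le> TJ UNIV * \<alpha>"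
      unfolding TJ_def \<alpha>_def using q T T0
      by (intro mult_mono prod_mono prod_nonneg) (auto simp: plus1_def dist_int_def less_imp_le)
    finally show ?thesis
      using \<phi>0 by (simp add: X field_simps)
  qed
  \<comment> \<open>Directions $j$ with $T_j < \mu$ are too short to be cut into cells of length $T_j/\mu \ge 1$, so
    only those in a set \<open>J\<close> are kept and the others are sliced away one integer at a time. Choosing
    \<open>J\<close> to maximise $\mu$ makes $T_j \ge \mu$ on \<open>J\<close> and loses nothing in the final exponent.\<close>
  define M where "M J = (\<alpha> * TJ J / \<phi>0) powr (1 / real (CARD('m) + card J))" for J :: "'n set"
  have M0: "0 < M J" for J
    unfolding M_def using \<alpha>0 TJ0[of J] \<phi>0 by simp
  have Mpow: "M J ^ (CARD('m) + card J) = \<alpha> * TJ J / \<phi>0" for J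
  proof -
    have "0 < \<alpha> * TJ J / \<phi>0"
      using \<alpha>0 TJ0[of J] \<phi>0 by simp
    moreover have "M J ^ (CARD('m) + card J) = M J powr real (CARD('m) + card J)"
      by (rule powr_realpow[OF M0, symmetric])
    moreover have "1 / real (CARD('m) + card J) * real (CARD('m) + card J) = 1"
      using zero_less_card_finite[where 'a='m] by (intro nonzero_eq_divide_eq[THEN iffD1]) linarith+
    ultimately show ?thesis
      by (simp only: M_def powr_powr powr_one less_imp_le)
  qed
  obtain J where Jmax: "\<And>J'. M J' \<le> M J"
    using ex_greatest_value[of M] by metis
  define \<mu> where "\<mu> = M J"
  define d where "d = CARD('m) + card J"
  have d1: "1 \<le> d" "d \<le> k"
    unfolding d_def k_def by (auto simp: Suc_le_eq trans_le_add1 card_mono)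
  have \<mu>X: "(X / \<phi>0) powr (1 / real k) \<le> \<mu>"
    using Jmax[of UNIV] by (simp add: \<mu>_def M_def X k_def)
  have \<mu>1: "1 \<le> \<mu>"
    using \<mu>X ge_one_powr_ge_zero[OF \<open>1 \<le> X / \<phi>0\<close>, of "1 / real k"] by simp
  \<comment> \<open>By maximality, comparison with \<open>M (J - {j})\<close> gives
    \<open>\<mu> ^ d \<le> \<mu> ^ (d - 1) * T $ j\<close>, and the power of \<open>\<mu>\<close>
    cancels.\<close>
  have \<mu>T: "\<mu> \<le> T $ j" if j: "j \<in> J" for j
  proof -
    have c: "card J = Suc (card (J - {j}))"
      by (rule card.remove[OF finite j])
    have "\<mu> ^ Suc (CARD('m) + card (J - {j})) = \<alpha> * TJ J / \<phi>0"
      unfolding \<mu>_def Mpow[symmetric] c by simp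
    also have "\<dots> = M (J - {j}) ^ (CARD('m) + card (J - {j})) * T $ j"
      unfolding Mpow using prod.remove[OF finite j, of "($) T"] by (simp add: TJ_def)
    also have "\<dots> \<le> \<mu> ^ (CARD('m) + card (J - {j})) * T $ j"
      unfolding \<mu>_def using T0[of j] M0 Jmax by (intro mult_right_mono power_mono) (auto simp: less_imp_le)
    finally show ?thesis
      using \<mu>1 by (simp add: mult.commute)
  qed
  have \<mu>d: "\<mu> ^ d = \<alpha> * TJ J / \<phi>0"
    unfolding \<mu>_def d_def by (rule Mpow)
  have Tsplit: "TJ UNIV = TJ J * TJ (- J)"
    unfolding TJ_def by (subst prod.union_disjoint[symmetric]) (auto simp: Compl_partition)
  \<comment> \<open>The fibres of \<open>pr\<close> are the slices: it remembers exactly the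
    coordinates outside \<open>J\<close>.\<close>
  define pr where "pr q = (\<chi> j. if j \<in> J then 0 else q $ j)" for q :: "int^'n"
  have finQ: "finite Q"
  proof (rule finite_subset)
    show "Q \<subseteq> {q. \<forall>j. \<bar>0 + real_of_int (q $ j)\<bar> \<le> T $ j}"
      using Q by auto
    show "finite {q :: int^'n. \<forall>j. \<bar>0 + real_of_int (q $ j)\<bar> \<le> T $ j}"
      using T0 by (intro card_int_vec_near) (simp add: less_imp_le)
  qed
  have cpr: "real (card (pr ` Q)) \<le> 3 ^ CARD('n) * TJ (- J)"
  proof -
    define W where "W = {z :: int^'n. \<forall>j. \<bar>0 + real_of_int (z $ j)\<bar> \<le> (if j \<in> J then 0 else T $ j)}"
    have nn: "0 \<le> (if j \<in> J then 0 else T $ j)" for j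
      using T0[of j] by simp
    have "pr ` Q \<subseteq> W"
      using Q by (auto simp: W_def pr_def)
    moreover have "finite W"
      unfolding W_def by (rule card_int_vec_near(1)[OF nn])
    ultimately have "real (card (pr ` Q)) \<le> real (card W)"
      by (simp add: card_mono)
    also have "\<dots> \<le> (\<Prod>j\<in>UNIV. 2 * (if j \<in> J then 0 else T $ j) + 1)"
      unfolding W_def by (rule card_int_vec_near(2)[OF nn])
    also have "\<dots> \<le> 3 ^ CARD('n) * (\<Prod>j\<in>UNIV. if j \<in> - J then T $ j else 1)"
    proof (intro prod_le_const_times conjI)
      show "2 * (if j \<in> J then 0 else T $ j) + 1 \<le> 3 * (if j \<in> - J then T $ j else 1)" for j
        using T[of j] by simp
      show "0 \<le> 2 * (if j \<in> J then 0 else T $ j) + 1" for j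
        using T0[of j] by simp
    qed simp
    also have "(\<Prod>j\<in>UNIV. if j \<in> - J then T $ j else 1) = TJ (- J)"
      by (simp add: prod.If_cases TJ_def Compl_eq)
    finally show ?thesis .
  qed
  define C where "C = (16 * real k) ^ k"
  have fibre: "real (card {q \<in> Q. pr q = y}) \<le> C * (\<alpha> * TJ J + \<mu> ^ (d - 1))" if y: "y \<in> pr ` Q" for y
  proof -
    define F where "F = {q \<in> Q. pr q = y}"
    obtain q0 where q0: "q0 \<in> F"
      using y by (auto simp: F_def)
    \<comment> \<open>Rounding selects one \<open>p\<close> for each \<open>q\<close>, which yields
      the injectivity required in the hyperplane case. Subtracting the base point \<open>q0\<close>
      of the slice kills the coordinates outside \<open>J\<close>.\<close>
    define pp where "pp q = (\<chi> i. - round (row_app L i q))" for q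
    define e where "e q = lattice_vec L (pp q - pp q0) (q - q0)" for q
    define D where "D = e ` F"
    have "card D = card F"
      unfolding D_def by (intro card_image inj_onI) (simp add: e_def lattice_vec_inject)
    have e_Inl: "e q $ Inl i = (row_app L i q - of_int (round (row_app L i q))) - (row_app L i q0 - of_int (round (row_app L i q0)))" for q i
      by (simp add: e_def pp_def row_app_diff)
    have Fa: "\<bar>row_app L i q - of_int (round (row_app L i q))\<bar> \<le> a i" if "q \<in> F" for q i
      using that Q by (auto simp: F_def dist_int_def)
    have FT: "\<bar>real_of_int (q $ j)\<bar> \<le> T $ j" if "q \<in> F" for q j
      using that Q by (auto simp: F_def)
    have FJ: "q $ j = q0 $ j" if "q \<in> F" "j \<notin> J" for q j
    proof -
      have "pr q = pr q0"
        using that q0 by (simp add: F_def)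
      then have "pr q $ j = pr q0 $ j"
        by simp
      then show ?thesis
        using that by (simp add: pr_def)
    qed
    have D1: "D \<subseteq> {lattice_vec L p q |p q. \<forall>j. j \<notin> J \<longrightarrow> q $ j = 0}"
    proof
      fix v assume "v \<in> D"
      then obtain q where "q \<in> F" "v = lattice_vec L (pp q - pp q0) (q - q0)"
        by (auto simp: D_def e_def)
      then show "v \<in> {lattice_vec L p q |p q. \<forall>j. j \<notin> J \<longrightarrow> q $ j = 0}"
        using FJ by (intro CollectI exI[of _ "pp q - pp q0"] exI[of _ "q - q0"]) simp
    qed
    have D2: "\<bar>v $ Inl i\<bar> \<le> 2 * a i" if v: "v \<in> D" for v i
    proof -
      obtain q where q: "q \<in> F" "v = e q"
        using v by (auto simp: D_def)
      show ?thesis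
        unfolding q(2) e_Inl using Fa[OF q(1), of i] Fa[OF q0, of i] by linarith
    qed
    have D3: "\<bar>v $ Inr j\<bar> \<le> 2 * T $ j" if v: "v \<in> D" for v j
    proof -
      obtain q where q: "q \<in> F" "v = e q"
        using v by (auto simp: D_def)
      show ?thesis
        using FT[OF q(1), of j] FT[OF q0, of j] by (simp add: q(2) e_def)
    qed
    have D4: "p = p'" if "lattice_vec L p q \<in> D" "lattice_vec L p' q \<in> D" for p p' q
      using that by (auto simp: D_def e_def lattice_vec_inject)
    have "real (card D) \<le> C * (\<alpha> * TJ J) \<or> real (card D) \<le> C * \<mu> ^ (d - 1)"
    proof (cases "{v :: real^('m + 'n). \<forall>j. j \<notin> J \<longrightarrow> v $ Inr j = 0} \<subseteq> span D")
      case True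
      have "real (card D) \<le> (6 * (real k + 1)) ^ k * (\<alpha> * TJ J)"
        unfolding \<alpha>_def TJ_def k_def by (rule card_slice_full_span[OF a T D1 D2 D3 True])
      also have "\<dots> \<le> C * (\<alpha> * TJ J)"
        unfolding C_def using \<alpha>0 TJ0[of J] k2 by (intro mult_right_mono power_mono) auto
      finally show ?thesis ..
    next
      case False
      have "real (card D) \<le> (16 * real k * \<mu>) ^ (CARD('m) + card J - 1)"
        unfolding k_def
        by (rule card_slice_hyperplane[OF a T \<phi>0 bad \<mu>1 \<mu>T _ D1 D4 D2 D3 False])
          (use \<mu>d in \<open>simp_all add: d_def \<alpha>_def TJ_def\<close>)
      also have "\<dots> = (16 * real k) ^ (d - 1) * \<mu> ^ (d - 1)"
        by (simp add: power_mult_distrib d_def)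
      also have "\<dots> \<le> C * \<mu> ^ (d - 1)"
        unfolding C_def using d1 k2 \<mu>1 by (intro mult_right_mono power_increasing) auto
      finally show ?thesis ..
    qed
    moreover have "0 \<le> C * (\<alpha> * TJ J)" "0 \<le> C * \<mu> ^ (d - 1)"
      using \<alpha>0 TJ0[of J] \<mu>1 by (simp_all add: C_def)
    ultimately have "real (card D) \<le> C * (\<alpha> * TJ J) + C * \<mu> ^ (d - 1)"
      by linarith
    then show ?thesis
      using \<open>card D = card F\<close> by (simp add: F_def distrib_left)
  qed
  have "real (card Q) \<le> real (card (pr ` Q)) * (C * (\<alpha> * TJ J + \<mu> ^ (d - 1)))"
    by (rule card_le_image_times_fibre[OF finQ fibre])
  also have "\<dots> \<le> (3 ^ CARD('n) * TJ (- J)) * (C * (\<alpha> * TJ J + \<mu> ^ (d - 1)))"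
    using cpr \<alpha>0 TJ0[of J] \<mu>1 by (intro mult_right_mono) (auto simp: C_def)
  also have "\<dots> = 3 ^ CARD('n) * C * (X + TJ (- J) * \<mu> ^ (d - 1))"
    by (simp add: X Tsplit algebra_simps)
  also have "\<dots> \<le> 3 ^ CARD('n) * C * (X + (X / \<phi>0) powr (real (k - 1) / real k))"
  proof (intro mult_left_mono add_left_mono)
    \<comment> \<open>The left side equals \<open>X / (\<phi>0 * \<mu>)\<close>, and
      \<open>\<mu>\<close> is at least \<open>(X / \<phi>0) powr (1 / k)\<close>, the value of
      \<open>M\<close> at the full set of directions.\<close>
    have "\<mu> ^ d = \<mu> ^ (d - 1) * \<mu>"
      using d1 by (metis Suc_diff_1 less_le_trans power_Suc2 zero_less_one)
    then have "TJ (- J) * \<mu> ^ (d - 1) = TJ (- J) * (\<alpha> * TJ J / \<phi>0) / \<mu>"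
      using \<mu>1 \<mu>d by (simp add: field_simps)
    also have "\<dots> = X / \<phi>0 / \<mu>"
      by (simp add: X Tsplit)
    also have "\<dots> \<le> X / \<phi>0 / (X / \<phi>0) powr (1 / real k)"
      using \<mu>X \<mu>1 \<open>1 \<le> X / \<phi>0\<close> by (intro divide_left_mono mult_pos_pos) auto
    also have "\<dots> = (X / \<phi>0) powr (1 - 1 / real k)"
    proof -
      have "y / y powr (1 / real k) = y powr (1 - 1 / real k)" if "1 \<le> y" for y
        using that by (simp add: powr_diff)
      then show ?thesis
        using \<open>1 \<le> X / \<phi>0\<close> by blast
    qed
    also have "1 - 1 / real k = real (k - 1) / real k"
      using k2 by (simp add: field_simps of_nat_diff)
    finally show "TJ (- J) * \<mu> ^ (d - 1) \<le> (X / \<phi>0) powr (real (k - 1) / real k)" .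
  qed (simp add: C_def)
  finally show ?thesis
    by (simp add: C_def)
qed

section \<open>The hyperbolic region\<close>

lemma ex_le_sum_eq_nat:
  fixes r :: "'a \<Rightarrow> nat"
  assumes "finite A" "K \<le> sum r A"
  shows "\<exists>s. (\<forall>i\<in>A. s i \<le> r i) \<and> sum s A = K"
  using assms(2)
proof (induction K)
  case 0
  show ?case
    by (rule exI[of _ "\<lambda>_. 0"]) simp
next
  case (Suc K)
  then obtain s where s: "\<forall>i\<in>A. s i \<le> r i" "sum s A = K"
    by auto
  obtain i where i: "i \<in> A" "s i < r i"
    using s(2) Suc.prems sum_mono[of A r s] by (metis Suc_le_lessD not_le)
  have "sum (s(i := Suc (s i))) A = Suc (sum s A)"
    using sum.remove[OF assms(1) i(1), of s] sum.remove[OF assms(1) i(1), of "s(i := Suc (s i))"] by simp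
  then show ?case
    using s i by (intro exI[of _ "s(i := Suc (s i))"]) auto
qed

text \<open>One entry is determined by the others and the sum. This saved coordinate is why the
  logarithm appears to the power \<open>m - 1\<close>.\<close>

lemma card_compositions_le:
  shows "finite {s :: 'm::finite \<Rightarrow> nat. sum s UNIV = K}"
    and "card {s :: 'm::finite \<Rightarrow> nat. sum s UNIV = K} \<le> (K + 1) ^ (CARD('m) - 1)"
proof -
  let ?S = "{s :: 'm \<Rightarrow> nat. sum s UNIV = K}"
  obtain i0 :: 'm where True
    by simp
  define h where "h s = restrict s (UNIV - {i0})" for s :: "'m \<Rightarrow> nat"
  have inj: "inj_on h ?S"
  proof (rule inj_onI)
    fix s t assume st: "s \<in> ?S" "t \<in> ?S" "h s = h t"
    have off: "s i = t i" if "i \<noteq> i0" for i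
      using fun_cong[OF st(3), of i] that by (simp add: h_def)
    have "sum s (UNIV - {i0}) = sum t (UNIV - {i0})"
      using off by (intro sum.cong) auto
    then have "s i0 = t i0"
      using st(1,2) by (simp add: sum.remove[of UNIV i0])
    then show "s = t"
      using off by (metis ext)
  qed
  have sub: "h ` ?S \<subseteq> PiE (UNIV - {i0}) (\<lambda>_. {0..K})"
  proof
    fix y assume "y \<in> h ` ?S"
    then obtain s where s: "sum s UNIV = K" "y = h s"
      by auto
    have "s i \<le> K" for i
      using member_le_sum[of i UNIV s] s(1) by simp
    then show "y \<in> PiE (UNIV - {i0}) (\<lambda>_. {0..K})"
      unfolding s(2) h_def by (intro restrict_PiE_iff[THEN iffD2]) auto
  qed
  have fin: "finite (PiE (UNIV - {i0}) (\<lambda>_. {0..K}))"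
    by (intro finite_PiE) auto
  show "finite ?S"
    using inj sub fin by (metis finite_imageD finite_subset)
  show "card ?S \<le> (K + 1) ^ (CARD('m) - 1)"
    using card_inj_on_le[OF inj sub fin] by (simp add: card_PiE card_Diff_singleton)
qed

text \<open>Rounding \<open>ln (R / x i)\<close> down loses at most 1 per coordinate, which the
  summand \<open>CARD('m)\<close> in the hypothesis covers, so the rounded exponents sum to at least
  \<open>K\<close>. Lowering them until the sum is exactly \<open>K\<close> only enlarges the
  box.\<close>

lemma ex_exponential_box:
  fixes x :: "'m::finite \<Rightarrow> real" and K :: nat
  assumes x: "\<And>i. 0 < x i" "\<And>i. x i \<le> R" and K: "real K + real CARD('m) \<le> ln (R ^ CARD('m) / (\<Prod>i\<in>UNIV. x i))"
  obtains s :: "'m \<Rightarrow> nat" where "sum s UNIV = K" "\<And>i. x i \<le> R * exp (- real (s i))"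
proof -
  have R: "0 < R"
    using x by (meson less_le_trans)
  define r where "r i = nat \<lfloor>ln (R / x i)\<rfloor>" for i
  have nn: "0 \<le> ln (R / x i)" for i
    using x[of i] by simp
  have ne: "R / x i \<noteq> 0" for i
    using x(1)[of i] R by simp
  have "R ^ CARD('m) / (\<Prod>i\<in>UNIV. x i) = (\<Prod>i\<in>UNIV. R / x i)"
    by (simp add: prod_dividef)
  also have "ln \<dots> = (\<Sum>i\<in>UNIV. ln (R / x i))"
    by (rule ln_prod[OF finite ne])
  also have "\<dots> \<le> (\<Sum>i\<in>UNIV. real (r i) + 1)"
  proof (intro sum_mono)
    show "ln (R / x i) \<le> real (r i) + 1" for i
      using nn[of i] unfolding r_def by linarith
  qed
  also have "\<dots> = real (sum r UNIV) + real CARD('m)"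
    by (simp add: sum.distrib)
  finally have "K \<le> sum r UNIV"
    using K by linarith
  then obtain s where s: "\<forall>i. s i \<le> r i" "sum s UNIV = K"
    using ex_le_sum_eq_nat[of UNIV K r] by auto
  have "x i \<le> R * exp (- real (s i))" for i
  proof -
    have "real (s i) \<le> real (r i)"
      using s by simp
    also have "\<dots> \<le> ln (R / x i)"
      using nn[of i] by (simp add: r_def)
    finally have "exp (real (s i)) \<le> R / x i"
      using x[of i] R by (simp add: ln_ge_iff)
    then show ?thesis
      using x[of i] by (simp add: exp_minus field_simps)
  qed
  then show ?thesis
    using that s(2) by blast
qed

text \<open>All boxes with sides \<open>R * exp (- s i)\<close> and \<open>sum s UNIV = K\<close>
  have the same volume, at most \<open>exp (m + 1) * \<epsilon>\<close> as \<open>K\<close> exceeds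
  \<open>l - m - 1\<close>. There are at most \<open>(K + 1) ^ (m - 1)\<close> of them, and
  \<open>K + 1 \<le> l\<close>.\<close>

lemma card_hyperbolic_le:
  fixes L :: "real^'n^'m" and T :: "real^'n" and \<phi>0 \<epsilon> R :: real
  defines "k \<equiv> CARD('m) + CARD('n)" and "P \<equiv> (\<Prod>j\<in>UNIV. T $ j)"
  assumes T: "\<And>j. 1 \<le> T $ j" and \<phi>0: "0 < \<phi>0"
    and bad: "\<And>q :: int^'n. q \<noteq> 0 \<Longrightarrow> (\<And>j. \<bar>real_of_int (q $ j)\<bar> \<le> T $ j) \<Longrightarrow>
      \<phi>0 \<le> (\<Prod>j\<in>UNIV. plus1 \<bar>of_int (q $ j)\<bar>) * (\<Prod>i\<in>UNIV. dist_int (row_app L i q))"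
    and \<epsilon>: "0 < \<epsilon>" and R: "0 < R" and R\<epsilon>: "exp (real CARD('m)) \<le> R ^ CARD('m) / \<epsilon>"
  shows "real (card {q :: int^'n. q \<noteq> 0 \<and> (\<Prod>i\<in>UNIV. dist_int (row_app L i q)) < \<epsilon> \<and>
      (\<forall>i. dist_int (row_app L i q) \<le> R) \<and> (\<forall>j. \<bar>real_of_int (q $ j)\<bar> \<le> T $ j)})
    \<le> 3 ^ CARD('n) * (16 * real k) ^ k * exp (real CARD('m) + 1) * ln (R ^ CARD('m) / \<epsilon>) ^ (CARD('m) - 1) *
      (\<epsilon> * P + (\<epsilon> * P / \<phi>0) powr (real (k - 1) / real k))"
proof -
  define A where "A = {q :: int^'n. q \<noteq> 0 \<and> (\<Prod>i\<in>UNIV. dist_int (row_app L i q)) < \<epsilon> \<and>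
      (\<forall>i. dist_int (row_app L i q) \<le> R) \<and> (\<forall>j. \<bar>real_of_int (q $ j)\<bar> \<le> T $ j)}"
  define m where "m = CARD('m)"
  have m1: "1 \<le> m"
    by (simp add: m_def Suc_le_eq)
  define l where "l = ln (R ^ m / \<epsilon>)"
  have l: "real m \<le> l"
    using R\<epsilon> R \<epsilon> by (simp add: l_def m_def ln_ge_iff)
  \<comment> \<open>The subtraction of naturals does not truncate, because
    \<open>R\<epsilon>\<close> makes \<open>l\<close> at least \<open>m\<close>.\<close>
  define K where "K = nat \<lfloor>l\<rfloor> - m"
  have K: "real K + real m \<le> l" "l < real K + real m + 1"
  proof -
    have "int m \<le> \<lfloor>l\<rfloor>"
      using l by (simp add: le_floor_iff)
    then have "int K + int m = \<lfloor>l\<rfloor>"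
      unfolding K_def by linarith
    then have "real K + real m = real_of_int \<lfloor>l\<rfloor>"
      by (metis of_int_add of_int_of_nat_eq)
    then show "real K + real m \<le> l" "l < real K + real m + 1"
      by linarith+
  qed
  define c where "c = exp (real m + 1)"
  have c1: "1 \<le> c"
    by (simp add: c_def)
  have P0: "0 < P"
    unfolding P_def using T by (intro prod_pos) (auto intro: less_le_trans[OF zero_less_one])
  define \<theta> where "\<theta> = real (k - 1) / real k"
  have \<theta>: "0 \<le> \<theta>" "\<theta> \<le> 1"
    by (auto simp: \<theta>_def k_def divide_le_eq_1)
  define C where "C = 3 ^ CARD('n) * (16 * real k) ^ k"
  have C0: "0 \<le> C"
    by (simp add: C_def)
  define S where "S = {s :: 'm \<Rightarrow> nat. sum s UNIV = K}"
  define a where "a s i = R * exp (- real (s i))" for s :: "'m \<Rightarrow> nat" and i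
  define Q where "Q s = {q \<in> A. \<forall>i. dist_int (row_app L i q) \<le> a s i}" for s
  have Qs: "real (card (Q s)) \<le> C * (c * (\<epsilon> * P + (\<epsilon> * P / \<phi>0) powr \<theta>))" if s: "s \<in> S" for s
  proof -
    define X where "X = (\<Prod>i\<in>UNIV. a s i) * P"
    have "(\<Prod>i\<in>UNIV. a s i) = R ^ m * exp (- real K)"
      using s by (simp add: a_def prod.distrib m_def S_def sum_negf flip: exp_sum of_nat_sum)
    also have "\<dots> \<le> R ^ m * (c * exp (- l))"
      using K(2) R by (intro mult_left_mono) (simp_all add: c_def flip: exp_add)
    also have "\<dots> = c * \<epsilon>"
      using R \<epsilon> by (simp add: l_def exp_minus)
    finally have Xle: "X \<le> c * (\<epsilon> * P)"
      unfolding X_def using P0 by (metis mult.assoc mult_right_mono less_imp_le)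
    have X0: "0 \<le> X"
      unfolding X_def using P0 R by (intro mult_nonneg_nonneg prod_nonneg) (auto simp: a_def)
    \<comment> \<open>The constant leaves the power as \<open>c powr \<theta> \<le> c\<close>, since
      \<open>1 \<le> c\<close> and \<open>\<theta> \<le> 1\<close>.\<close>
    have "(X / \<phi>0) powr \<theta> \<le> (c * (\<epsilon> * P / \<phi>0)) powr \<theta>"
      using Xle X0 \<phi>0 \<theta> by (intro powr_mono2) (auto simp: divide_right_mono)
    also have "\<dots> = c powr \<theta> * (\<epsilon> * P / \<phi>0) powr \<theta>"
      by (rule powr_mult)
    also have "\<dots> \<le> c powr 1 * (\<epsilon> * P / \<phi>0) powr \<theta>"
      using c1 \<theta> by (intro mult_right_mono powr_mono) auto
    finally have powle: "(X / \<phi>0) powr \<theta> \<le> c * (\<epsilon> * P / \<phi>0) powr \<theta>"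
      using c1 by simp
    have "real (card (Q s)) \<le> C * (X + (X / \<phi>0) powr \<theta>)"
      unfolding C_def X_def P_def \<theta>_def k_def
      by (rule card_box_le[OF _ T \<phi>0 bad]) (use R in \<open>auto simp: a_def Q_def A_def\<close>)
    also have "\<dots> \<le> C * (c * (\<epsilon> * P + (\<epsilon> * P / \<phi>0) powr \<theta>))"
      using Xle powle C0 by (intro mult_left_mono) (auto simp: distrib_left)
    finally show ?thesis .
  qed
  have "A \<subseteq> (\<Union>s\<in>S. Q s)"
  proof
    fix q assume q: "q \<in> A"
    \<comment> \<open>Bad approximability excludes distance 0, so the logarithms behind the choice
      of the box are meaningful.\<close>
    have "\<phi>0 \<le> (\<Prod>j\<in>UNIV. plus1 \<bar>of_int (q $ j)\<bar>) * (\<Prod>i\<in>UNIV. dist_int (row_app L i q))"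
      using q by (intro bad) (auto simp: A_def)
    then have "(\<Prod>i\<in>UNIV. dist_int (row_app L i q)) \<noteq> 0"
      using \<phi>0 by (metis mult_zero_right not_le)
    then have pos: "0 < dist_int (row_app L i q)" for i
      by (simp add: less_le)
    have pp: "0 < (\<Prod>i\<in>UNIV. dist_int (row_app L i q))"
      using pos by (intro prod_pos) auto
    have "R ^ m / \<epsilon> \<le> R ^ m / (\<Prod>i\<in>UNIV. dist_int (row_app L i q))"
      using q pp R \<epsilon> by (intro divide_left_mono) (auto simp: A_def)
    then have "l \<le> ln (R ^ m / (\<Prod>i\<in>UNIV. dist_int (row_app L i q)))"
      unfolding l_def using R \<epsilon> pp by simp
    then have "real K + real CARD('m) \<le> ln (R ^ CARD('m) / (\<Prod>i\<in>UNIV. dist_int (row_app L i q)))"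
      using K by (simp add: m_def)
    then obtain s where "sum s UNIV = K" "\<And>i. dist_int (row_app L i q) \<le> R * exp (- real (s i))"
      using pos q ex_exponential_box[of "\<lambda>i. dist_int (row_app L i q)" R K] by (auto simp: A_def)
    then show "q \<in> (\<Union>s\<in>S. Q s)"
      using q by (auto simp: S_def Q_def a_def)
  qed
  then have "A = (\<Union>s\<in>S. Q s)"
    by (auto simp: Q_def)
  moreover have "finite S"
    unfolding S_def by (rule card_compositions_le)
  ultimately have "real (card A) \<le> real (\<Sum>s\<in>S. card (Q s))"
    using card_UN_le[of S Q] by (simp only: of_nat_le_iff)
  also have "\<dots> \<le> (\<Sum>s\<in>S. C * (c * (\<epsilon> * P + (\<epsilon> * P / \<phi>0) powr \<theta>)))"
    unfolding of_nat_sum by (intro sum_mono Qs)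
  also have "\<dots> = real (card S) * (C * (c * (\<epsilon> * P + (\<epsilon> * P / \<phi>0) powr \<theta>)))"
    by simp
  also have "\<dots> \<le> l ^ (m - 1) * (C * (c * (\<epsilon> * P + (\<epsilon> * P / \<phi>0) powr \<theta>)))"
  proof (intro mult_right_mono)
    have "real (card S) \<le> real ((K + 1) ^ (m - 1))"
      using card_compositions_le(2)[where 'm='m, of K] unfolding S_def m_def of_nat_le_iff .
    also have "\<dots> = (real K + 1) ^ (m - 1)"
      by (simp add: add.commute)
    also have "\<dots> \<le> l ^ (m - 1)"
      using K(1) m1 by (intro power_mono) auto
    finally show "real (card S) \<le> l ^ (m - 1)" .
    show "0 \<le> C * (c * (\<epsilon> * P + (\<epsilon> * P / \<phi>0) powr \<theta>))"
      using C0 c1 \<epsilon> P0 by (intro mult_nonneg_nonneg add_nonneg_nonneg) auto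
  qed
  finally show ?thesis
    unfolding A_def[symmetric] by (simp add: l_def m_def C_def c_def \<theta>_def mult_ac)
qed

section \<open>From pairs (p, q) to vectors q, and assembly of the bound\<close>

lemma dist_int_le_half: "dist_int x \<le> 1 / 2"
  using of_int_round_abs_le[of x] by (simp add: dist_int_def abs_minus_commute)

text \<open>Rounding can only shrink the distances, so every \<open>q\<close> occurring in
  \<open>Mset\<close> lies in \<open>A\<close>, and it occurs with at most
  \<open>(2 * R + 1) ^ CARD('m)\<close> vectors \<open>p\<close>. The last bound forgets all
  approximation conditions; it serves when \<open>\<epsilon>\<close> is not small.\<close>

lemma Mset_card_le_hyperbolic:
  fixes L :: "real^'n^'m" and T :: "real^'n" and \<epsilon> R :: real
  defines "A \<equiv> {q :: int^'n. q \<noteq> 0 \<and> (\<Prod>i\<in>UNIV. dist_int (row_app L i q)) < \<epsilon> \<and>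
      (\<forall>i. dist_int (row_app L i q) \<le> min R (1 / 2)) \<and> (\<forall>j. \<bar>real_of_int (q $ j)\<bar> \<le> T $ j)}"
  assumes R: "0 \<le> R" and T: "\<And>j. 1 \<le> T $ j"
  shows "finite (Mset L \<epsilon> R T)"
    and "real (card (Mset L \<epsilon> R T)) \<le> 2 ^ CARD('m) * (1 + R) ^ CARD('m) * real (card A)"
    and "real (card A) \<le> 3 ^ CARD('n) * (\<Prod>j\<in>UNIV. T $ j)"
proof -
  have T0: "0 \<le> T $ j" for j
    using T[of j] by linarith
  define W where "W = {q :: int^'n. \<forall>j. \<bar>0 + real_of_int (q $ j)\<bar> \<le> T $ j}"
  have W: "finite W" "real (card W) \<le> (\<Prod>j\<in>UNIV. 2 * T $ j + 1)"
    unfolding W_def by (rule card_int_vec_near[OF T0])+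
  have AW: "A \<subseteq> W"
    by (auto simp: A_def W_def)
  have finA: "finite A"
    using AW W(1) finite_subset by blast
  define B where "B q = {p :: int^'m. \<forall>i. \<bar>row_app L i q + of_int (p $ i)\<bar> \<le> R}" for q
  have B: "finite (B q)" "real (card (B q)) \<le> (\<Prod>i\<in>(UNIV :: 'm set). 2 * R + 1)" for q
    unfolding B_def by (rule card_int_vec_near[OF R])+
  have MA: "snd ` Mset L \<epsilon> R T \<subseteq> A"
  proof clarify
    fix p q assume pq: "(p, q) \<in> Mset L \<epsilon> R T"
    have "(\<Prod>i\<in>UNIV. dist_int (row_app L i q)) \<le> (\<Prod>i\<in>UNIV. \<bar>row_app L i q + of_int (p $ i)\<bar>)"
      by (intro prod_mono conjI dist_int_le) (simp add: dist_int_def)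
    moreover have "dist_int (row_app L i q) \<le> R" for i
      using pq dist_int_le[of "row_app L i q" "p $ i"] by (auto simp: Mset_def intro: order_trans)
    ultimately have "q \<in> A"
      using pq dist_int_le_half by (auto simp: A_def Mset_def)
    then show "snd (p, q) \<in> A"
      by simp
  qed
  have MB: "Mset L \<epsilon> R T \<subseteq> (\<lambda>(q, p). (p, q)) ` (SIGMA q:A. B q)"
    using MA by (force simp: Mset_def B_def)
  show finM: "finite (Mset L \<epsilon> R T)"
    using MB finA B(1) by (meson finite_SigmaI finite_imageI finite_subset)
  have fibre: "real (card {z \<in> Mset L \<epsilon> R T. snd z = q}) \<le> (2 * (1 + R)) ^ CARD('m)" for q
  proof -
    have "fst ` {z \<in> Mset L \<epsilon> R T. snd z = q} \<subseteq> B q"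
      by (auto simp: Mset_def B_def)
    moreover have "inj_on fst {z \<in> Mset L \<epsilon> R T. snd z = q}"
      by (auto simp: inj_on_def)
    ultimately have "card {z \<in> Mset L \<epsilon> R T. snd z = q} \<le> card (B q)"
      using B(1) by (intro card_inj_on_le)
    then have "real (card {z \<in> Mset L \<epsilon> R T. snd z = q}) \<le> real (card (B q))"
      by simp
    also have "\<dots> \<le> (2 * R + 1) ^ CARD('m)"
      using B(2)[of q] by simp
    also have "\<dots> \<le> (2 * (1 + R)) ^ CARD('m)"
      using R by (intro power_mono) auto
    finally show ?thesis .
  qed
  have "real (card (Mset L \<epsilon> R T)) \<le> real (card (snd ` Mset L \<epsilon> R T)) * (2 * (1 + R)) ^ CARD('m)"
    by (rule card_le_image_times_fibre[OF finM fibre])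
  also have "\<dots> \<le> real (card A) * (2 * (1 + R)) ^ CARD('m)"
    using R card_mono[OF finA MA] by (intro mult_right_mono) auto
  finally show "real (card (Mset L \<epsilon> R T)) \<le> 2 ^ CARD('m) * (1 + R) ^ CARD('m) * real (card A)"
    unfolding power_mult_distrib by (simp only: mult_ac)
  have "real (card A) \<le> real (card W)"
    using card_mono[OF W(1) AW] by simp
  also have "\<dots> \<le> (\<Prod>j\<in>UNIV. 2 * T $ j + 1)"
    by (rule W(2))
  also have "\<dots> \<le> 3 ^ CARD('n) * (\<Prod>j\<in>UNIV. T $ j)"
  proof (intro prod_le_const_times conjI)
    show "0 \<le> 2 * T $ j + 1" "2 * T $ j + 1 \<le> 3 * T $ j" for j
      using T[of j] by linarith+
  qed simp
  finally show "real (card A) \<le> 3 ^ CARD('n) * (\<Prod>j\<in>UNIV. T $ j)" .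
qed

text \<open>Monotonicity replaces the value of \<open>\<phi>\<close> at the height of each
  \<open>q\<close> by one constant for the whole box, the \<open>\<phi>0\<close> of the counting
  lemmas.\<close>

lemma mult_bad_approx_on_box:
  fixes L :: "real^'n^'m" and T :: "real^'n" and \<phi> :: "real \<Rightarrow> real"
  assumes mono: "\<And>x y. 0 \<le> x \<Longrightarrow> x \<le> y \<Longrightarrow> \<phi> y \<le> \<phi> x" and bad: "mult_bad_approx \<phi> L"
    and T: "\<And>j. 1 \<le> T $ j" and q: "q \<noteq> 0" "\<And>j. \<bar>real_of_int (q $ j)\<bar> \<le> T $ j"
  shows "\<phi> ((\<Prod>j\<in>UNIV. T $ j) powr (1 / real CARD('n)))
    \<le> (\<Prod>j\<in>UNIV. plus1 \<bar>of_int (q $ j)\<bar>) * (\<Prod>i\<in>UNIV. dist_int (row_app L i q))"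
proof -
  have "(\<Prod>j\<in>UNIV. plus1 \<bar>of_int (q $ j)\<bar>) \<le> (\<Prod>j\<in>UNIV. T $ j)"
    using q T by (intro prod_mono) (auto simp: plus1_def)
  moreover have "0 \<le> (\<Prod>j\<in>UNIV. plus1 \<bar>real_of_int (q $ j)\<bar>)"
    by (intro prod_nonneg) (simp add: plus1_def)
  ultimately have "\<phi> ((\<Prod>j\<in>UNIV. T $ j) powr (1 / real CARD('n)))
    \<le> \<phi> ((\<Prod>j\<in>UNIV. plus1 \<bar>of_int (q $ j)\<bar>) powr (1 / real CARD('n)))"
    by (intro mono powr_mono2) auto
  also have "\<dots> \<le> (\<Prod>j\<in>UNIV. plus1 \<bar>of_int (q $ j)\<bar>) * (\<Prod>i\<in>UNIV. dist_int (row_app L i q))"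
    using bad q(1) unfolding mult_bad_approx_def by blast
  finally show ?thesis .
qed

text \<open>The constant is chosen before all the data, so it depends on the dimensions alone.
  Finiteness is asserted separately because \<open>card\<close> is 0 on infinite sets.\<close>

theorem mainTheorem1:
  "\<exists>c>0. \<forall>(\<phi>::real \<Rightarrow> real) (L::real^'n^'m) (\<epsilon>::real) (R::real) (T::real^'n).
     (\<forall>x\<ge>0. 0 < \<phi> x \<and> \<phi> x \<le> 1) \<longrightarrow>
     (\<forall>x y. 0 \<le> x \<longrightarrow> x \<le> y \<longrightarrow> \<phi> y \<le> \<phi> x) \<longrightarrow>
     mult_bad_approx \<phi> L \<longrightarrow>
     \<epsilon> > 0 \<longrightarrow> R > 0 \<longrightarrow> R ^ CARD('m) / \<epsilon> \<ge> exp (real CARD('m)) \<longrightarrow>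
     (\<forall>j. 1 \<le> T $ j) \<longrightarrow>
     (let Tb = (\<Prod>j\<in>UNIV. T $ j) powr (1 / real CARD('n));
          k = CARD('m) + CARD('n) in
      finite (Mset L \<epsilon> R T) \<and>
      real (card (Mset L \<epsilon> R T)) \<le>
        c * (1 + R) ^ (k - 1) * (ln (R ^ CARD('m) / \<epsilon>)) ^ (CARD('m) - 1) *
          (\<epsilon> * Tb ^ CARD('n) + (\<epsilon> * Tb ^ CARD('n) / \<phi> Tb) powr (real (k - 1) / real k)))"
proof -
  define k where "k = CARD('m) + CARD('n)"
  \<comment> \<open>\<open>C1\<close> belongs to the hyperbolic count, \<open>C2\<close> to the
    trivial count used when \<open>\<epsilon>\<close> exceeds
    \<open>1 / (2 * exp 1) ^ CARD('m)\<close>.\<close>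
  define C1 where "C1 = 3 ^ CARD('n) * (16 * real k) ^ k * exp (real CARD('m) + 1)"
  define C2 where "C2 = 3 ^ CARD('n) * (2 * exp 1 :: real) ^ CARD('m)"
  define c where "c = 2 ^ CARD('m) * (C1 + C2)"
  have C: "0 \<le> C1" "0 < C2"
    by (simp_all add: C1_def C2_def)
  have "0 < c"
    using C by (simp add: c_def)
  moreover have "let Tb = (\<Prod>j\<in>UNIV. T $ j) powr (1 / real CARD('n)); k = CARD('m) + CARD('n) in
      finite (Mset L \<epsilon> R T) \<and>
      real (card (Mset L \<epsilon> R T)) \<le>
        c * (1 + R) ^ (k - 1) * (ln (R ^ CARD('m) / \<epsilon>)) ^ (CARD('m) - 1) *
          (\<epsilon> * Tb ^ CARD('n) + (\<epsilon> * Tb ^ CARD('n) / \<phi> Tb) powr (real (k - 1) / real k))"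
    if \<phi>: "\<forall>x\<ge>0. 0 < \<phi> x \<and> \<phi> x \<le> 1" "\<forall>x y. 0 \<le> x \<longrightarrow> x \<le> y \<longrightarrow> \<phi> y \<le> \<phi> x" "mult_bad_approx \<phi> L"
      and \<epsilon>: "0 < \<epsilon>" and R: "0 < R" and R\<epsilon>: "exp (real CARD('m)) \<le> R ^ CARD('m) / \<epsilon>"
      and T: "\<forall>j. 1 \<le> T $ j"
    for \<phi> :: "real \<Rightarrow> real" and L :: "real^'n^'m" and \<epsilon> R :: real and T :: "real^'n"
  proof -
    define P where "P = (\<Prod>j\<in>UNIV. T $ j)"
    define Tb where "Tb = P powr (1 / real CARD('n))"
    define r where "r = min R (1 / 2)"
    define lg where "lg = ln (R ^ CARD('m) / \<epsilon>)"
    define E where "E = \<epsilon> * P + (\<epsilon> * P / \<phi> Tb) powr (real (k - 1) / real k)"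
    define A where "A = {q :: int^'n. q \<noteq> 0 \<and> (\<Prod>i\<in>UNIV. dist_int (row_app L i q)) < \<epsilon> \<and>
      (\<forall>i. dist_int (row_app L i q) \<le> r) \<and> (\<forall>j. \<bar>real_of_int (q $ j)\<bar> \<le> T $ j)}"
    have T1: "1 \<le> T $ j" for j
      using T by simp
    have "1 \<le> P"
      unfolding P_def by (intro prod_ge_1 T1)
    have Tbn: "Tb ^ CARD('n) = P"
    proof -
      have "Tb ^ CARD('n) = Tb powr real CARD('n)"
        using \<open>1 \<le> P\<close> by (intro powr_realpow[symmetric]) (simp add: Tb_def)
      also have "\<dots> = P"
        using \<open>1 \<le> P\<close> by (simp add: Tb_def powr_powr)
      finally show ?thesis .
    qed
    have \<phi>0: "0 < \<phi> Tb"
      using \<phi>(1) by (simp add: Tb_def)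
    have bad: "\<phi> Tb \<le> (\<Prod>j\<in>UNIV. plus1 \<bar>of_int (q $ j)\<bar>) * (\<Prod>i\<in>UNIV. dist_int (row_app L i q))"
      if "q \<noteq> 0" "\<And>j. \<bar>real_of_int (q $ j)\<bar> \<le> T $ j" for q
      unfolding Tb_def P_def using \<phi>(2) by (intro mult_bad_approx_on_box[OF _ \<phi>(3) T1 that]) auto
    note M = Mset_card_le_hyperbolic[OF less_imp_le[OF R] T1, where L = L and \<epsilon> = \<epsilon>, folded r_def, folded A_def, folded P_def]
    have E0: "0 \<le> \<epsilon> * P" "\<epsilon> * P \<le> E"
      using \<epsilon> \<open>1 \<le> P\<close> by (auto simp: E_def)
    have lg1: "1 \<le> lg"
    proof -
      have "real CARD('m) \<le> lg"
        using R\<epsilon> R \<epsilon> by (simp add: lg_def ln_ge_iff)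
      moreover have "1 \<le> real CARD('m)"
        using zero_less_card_finite[where 'a='m] by linarith
      ultimately show ?thesis
        by linarith
    qed
    have r: "0 < r" "r \<le> R"
      using R by (auto simp: r_def)
    have cardA: "real (card A) \<le> (C1 + C2) * lg ^ (CARD('m) - 1) * E"
    proof (cases "exp (real CARD('m)) \<le> r ^ CARD('m) / \<epsilon>")
      case True
      have "real (card A) \<le> C1 * ln (r ^ CARD('m) / \<epsilon>) ^ (CARD('m) - 1) * E"
        unfolding A_def C1_def E_def P_def k_def
        by (rule card_hyperbolic_le[OF T1 \<phi>0 bad \<epsilon> r(1) True])
      also have "\<dots> \<le> (C1 + C2) * lg ^ (CARD('m) - 1) * E"
      proof (intro mult_mono mult_right_mono power_mono)
        have "1 \<le> r ^ CARD('m) / \<epsilon>"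
          using True by (meson one_le_exp_iff of_nat_0_le_iff order_trans)
        then show "0 \<le> ln (r ^ CARD('m) / \<epsilon>)"
          by simp
        have "r ^ CARD('m) / \<epsilon> \<le> R ^ CARD('m) / \<epsilon>"
          using r \<epsilon> by (intro divide_right_mono power_mono) auto
        then show "ln (r ^ CARD('m) / \<epsilon>) \<le> lg"
          unfolding lg_def using \<open>1 \<le> r ^ CARD('m) / \<epsilon>\<close> by (intro ln_mono) auto
        then show "0 \<le> (C1 + C2) * lg ^ (CARD('m) - 1)"
          using C lg1 by simp
        show "0 \<le> ln (r ^ CARD('m) / \<epsilon>) ^ (CARD('m) - 1)"
          using \<open>0 \<le> ln (r ^ CARD('m) / \<epsilon>)\<close> by simp
      qed (use C E0 in auto)
      finally show ?thesis .
    next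
      case False
      \<comment> \<open>Here \<open>r\<close> is 1/2 and \<open>\<epsilon>\<close> is bounded below
        in terms of m, so the number of all \<open>q\<close> in the box, of order \<open>P\<close>,
        is already at most a constant times \<open>\<epsilon> * P\<close>.\<close>
      then have "r \<noteq> R"
        using R\<epsilon> by auto
      then have "r = 1 / 2"
        by (auto simp: r_def min_def split: if_splits)
      then have half: "(1 / 2) ^ CARD('m) < exp (real CARD('m)) * \<epsilon>"
        using False \<epsilon> by (simp only: not_le pos_divide_less_eq)
      have "1 = 2 ^ CARD('m) * (1 / 2 :: real) ^ CARD('m)"
        by (simp flip: power_mult_distrib)
      also have "\<dots> < 2 ^ CARD('m) * (exp (real CARD('m)) * \<epsilon>)"
        using half by (rule mult_strict_left_mono) simp
      also have "\<dots> = (2 * exp 1) ^ CARD('m) * \<epsilon>"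
        using exp_of_nat_mult[of "CARD('m)" "1::real"] by (simp add: power_mult_distrib)
      finally have *: "1 < (2 * exp 1) ^ CARD('m) * \<epsilon>" .
      have "real (card A) \<le> 3 ^ CARD('n) * P * 1"
        using M(3) by simp
      also have "\<dots> \<le> 3 ^ CARD('n) * P * ((2 * exp 1) ^ CARD('m) * \<epsilon>)"
        using * \<open>1 \<le> P\<close> by (intro mult_left_mono) auto
      also have "\<dots> = C2 * (\<epsilon> * P)"
        by (simp add: C2_def)
      also have "\<dots> \<le> (C1 + C2) * lg ^ (CARD('m) - 1) * E"
      proof (intro mult_mono)
        have "C2 * 1 \<le> (C1 + C2) * lg ^ (CARD('m) - 1)"
          using C lg1 by (intro mult_mono) (auto intro: one_le_power)
        then show "C2 \<le> (C1 + C2) * lg ^ (CARD('m) - 1)"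
          by simp
      qed (use C E0 lg1 in auto)
      finally show ?thesis .
    qed
    have "real (card (Mset L \<epsilon> R T)) \<le> 2 ^ CARD('m) * (1 + R) ^ CARD('m) * ((C1 + C2) * lg ^ (CARD('m) - 1) * E)"
      using M(2) cardA R by (elim order_trans) (intro mult_left_mono, auto)
    also have "\<dots> \<le> 2 ^ CARD('m) * (1 + R) ^ (k - 1) * ((C1 + C2) * lg ^ (CARD('m) - 1) * E)"
    proof (intro mult_right_mono mult_left_mono power_increasing)
      \<comment> \<open>Only the choice of \<open>p\<close> brings in powers of
        \<open>1 + R\<close>, namely m of them, and n is at least 1.\<close>
      show "CARD('m) \<le> k - 1"
        using zero_less_card_finite[where 'a='n] unfolding k_def by linarith
    qed (use R C lg1 E0 in auto)
    also have "\<dots> = c * (1 + R) ^ (k - 1) * lg ^ (CARD('m) - 1) * E"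
      by (simp add: c_def)
    finally show ?thesis
      unfolding Let_def P_def[symmetric] Tb_def[symmetric] k_def[symmetric] Tbn
      using M(1) by (simp add: lg_def E_def)
  qed
  ultimately show ?thesis
    by blast
qed

end
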